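(* Let $s\in\mathbb{R}$ and for each integer $k\ge 1$ let $F_k(\rho)=\sum_{i\ge 0}c_{i,k}\rho^{i-1}$ be a formal Laurent series with at most a simple pole. Consider the Dyson--Schwinger equation \[ G(x,L)=1+\sum_{k\ge1}x^k\,G\!\left(x,\tfrac{\partial}{\partial\rho}\right)^{1+sk}(e^{L\rho}-1)F_k(\rho)\Big|_{\rho=0} \] for a power series $G(x,L)$ in $x$ with coefficients polynomials in $L$ and constant term $1$. Then the solution is given by a sum over tubings of weighted rooted trees as follows. 1. For a weighted rooted tree $t$ and a binary tubing $\tau$ of $t$, set \[ \phi_L(\tau)=c(\tau)\sum_{i=1}^{b(\tau)}c_{b(\tau)-i,\,w(\operatorname{rt}(t))}\frac{L^i}{i!}. \] 2. The solution is \[ G(x,L)=1+\sum_{t}\frac{x^{w(t)}}{|\operatorname{Aut}(t)|}\Big(\prod_{v\in V(t)}(1+sw(v))_{\mathrm{od}(v)}\Big)\sum_{\tau\in\mathrm{Tub}(t)}\phi_L(\tau), \] where the outer sum is over all (nonempty) weighted rooted trees $t$. 3. In particular, the anomalous dimension is \[ \gamma(x)=[L^1]G(x,L)=\sum_{t}\frac{x^{w(t)}}{|\operatorname{Aut}(t)|}\Big(\prod_{v\in V(t)}(1+sw(v))_{\mathrm{od}(v)}\Big)\sum_{\tau\in\mathrm{Tub}(t)}\prod_{v\in V(t)}c_{b(v,\tau)-1,\,w(v)}. \]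
   Context: Meaning of the equation: since $G$ has constant term $1$, $G(x,L)^{1+sk}$ is defined by the binomial series and is a power series in $x$ with coefficients in $\mathbb{R}[L]$; substituting $L\mapsto \partial/\partial\rho$ gives differential operators applied to the Laurent series $(e^{L\rho}-1)F_k(\rho)$, and $|_{\rho=0}$ means evaluating at $\rho=0$ (the result is polynomial in $L$). A rooted tree is a root vertex together with a (possibly empty) multiset of rooted trees whose roots are the children of the root; $\mathrm{od}(v)$ is the number of children of $v$, $\operatorname{rt}(t)$ the root. A weighted rooted tree has a weight $w(v)\in\mathbb{Z}_{\ge1}$ at each vertex; $w(t)=\sum_v w(v)$. $\operatorname{Aut}(t)$ is the group of root-preserving, weight-preserving graph automorphisms. $(y)_k=y(y-1)\cdots(y-k+1)$, $(y)_0=1$. A tube of $t$ is a set of vertices inducing a connected subgraph. A binary tubing $\tau$ of $t$ is a set of tubes containing $V(t)$ such that every tube of $\tau$ is either a single vertex or is partitioned by two other tubes of $\tau$. $\mathrm{Tub}(t)$ is the set of binary tubings of $t$. The $b$-statistic $b(v,\tau)$ is the number of tubes of $\tau$ in which $v$ is the root (the vertex closest to $\operatorname{rt}(t)$); $b(\tau)=b(\operatorname{rt}(t),\tau)$. The Mellin monomial is $c(\tau)=\prod_{v\in V(t),\,v\ne \operatorname{rt}(t)}c_{b(v,\tau)-1,\,w(v)}$.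
   Formalization: The tubes of a binary tubing are additionally required to be pairwise nested or disjoint; without this, the union of the two binary tubings of a 3-vertex path would also count as a tubing and the formula would fail. *)

theory Defs
  imports
    "HOL-Analysis.Infinite_Sum"
    "HOL-Computational_Algebra.Formal_Laurent_Series"
    "HOL-Combinatorics.Permutations"
    "HOL-Library.Multiset"
begin

section \<open>The Dyson--Schwinger equation\<close>

text \<open>
  A power series in \<open>x\<close> with coefficients in \<open>\<real>[L]\<close> is a \<^typ>\<open>real poly fps\<close>. Laurent series in
  \<open>\<rho>\<close> with coefficients in \<open>\<real>[L]\<close> are \<^typ>\<open>real poly fls\<close>. Infinite sums of power series in \<open>x\<close>
  refer to the \<open>x\<close>-adic topology of \<^typ>\<open>'a fps\<close>.
\<close>

text \<open>\<open>G\<^sup>a = \<Sum>n. (a gchoose n) (G - 1)\<^sup>n\<close>, meaningful when \<open>G\<close> has constant term \<open>1\<close>.\<close>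

definition binomial_power :: "real poly fps \<Rightarrow> real \<Rightarrow> real poly fps" where
  "binomial_power G a = fps_compose (Abs_fps (\<lambda>n. [:a gchoose n:])) (G - 1)"

text \<open>\<open>p(\<partial>/\<partial>\<rho>) H\<close>: the variable of \<open>p\<close> is replaced by the derivation, hence the coefficients of
  \<open>p\<close> become constants of \<open>\<real>[L]\<close>.\<close>

definition diff_op :: "real poly \<Rightarrow> real poly fls \<Rightarrow> real poly fls" where
  "diff_op p H = (\<Sum>j\<le>degree p. fls_const [:coeff p j:] * (fls_deriv ^^ j) H)"

text \<open>\<open>P(x, \<partial>/\<partial>\<rho>) H |\<^bsub>\<rho>=0\<^esub>\<close>, where evaluation at \<open>\<rho> = 0\<close> is the coefficient of \<open>\<rho>\<^sup>0\<close>. It is only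
  applied to \<open>H = (e\<^bsup>L\<rho>\<^esup> - 1) F\<^sub>k(\<rho>)\<close>, which has no pole if \<open>F\<^sub>k\<close> has at most a simple one.\<close>

definition diff_op_at_0 :: "real poly fps \<Rightarrow> real poly fls \<Rightarrow> real poly fps" where
  "diff_op_at_0 P H = Abs_fps (\<lambda>m. fls_nth (diff_op (fps_nth P m) H) 0)"

definition exp_L_rho :: "real poly fls" where
  "exp_L_rho = fps_to_fls (Abs_fps (\<lambda>n. monom (1 / fact n) n))"

lift_definition fls_pconst :: "real fls \<Rightarrow> real poly fls" is "\<lambda>f n. [:f n:]"
  by (auto elim: MOST_mono)

definition dse_solution :: "real \<Rightarrow> (nat \<Rightarrow> real fls) \<Rightarrow> real poly fps \<Rightarrow> bool" where
  "dse_solution s F G \<longleftrightarrow>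
     fps_nth G 0 = 1 \<and>
     ((\<lambda>k. fps_X ^ k *
          diff_op_at_0 (binomial_power G (1 + s * real k)) ((exp_L_rho - 1) * fls_pconst (F k)))
        has_sum (G - 1)) {1..}"


section \<open>Weighted rooted trees\<close>

datatype wtree = Node (root_weight: nat) (subtrees: "wtree multiset")

text \<open>
  A vertex is the path leading to it from the root: each step \<open>(u, i)\<close> selects the \<open>i\<close>-th of the
  \<^term>\<open>count (subtrees t) u\<close> copies of the child tree \<open>u\<close>. In particular the root is \<^term>\<open>[]\<close> and
  the distance of a vertex from the root is its length.
\<close>

type_synonym vertex = "(wtree \<times> nat) list"

fun is_vertex :: "wtree \<Rightarrow> vertex \<Rightarrow> bool" where
  "is_vertex t [] \<longleftrightarrow> True"
| "is_vertex t ((u, i) # p) \<longleftrightarrow> i < count (subtrees t) u \<and> is_vertex u p"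

definition verts :: "wtree \<Rightarrow> vertex set" where
  "verts t = {v. is_vertex t v}"

fun subtree_at :: "wtree \<Rightarrow> vertex \<Rightarrow> wtree" where
  "subtree_at t [] = t"
| "subtree_at t ((u, i) # p) = subtree_at u p"

definition vweight :: "wtree \<Rightarrow> vertex \<Rightarrow> nat" where
  "vweight t v = root_weight (subtree_at t v)"

definition weighted_trees :: "wtree set" where
  "weighted_trees = {t. \<forall>v\<in>verts t. vweight t v \<ge> 1}"

definition tweight :: "wtree \<Rightarrow> nat" where
  "tweight t = (\<Sum>v\<in>verts t. vweight t v)"

definition is_child :: "vertex \<Rightarrow> vertex \<Rightarrow> bool" where
  "is_child v v' \<longleftrightarrow> (\<exists>e. v' = v @ [e])"

definition od :: "wtree \<Rightarrow> vertex \<Rightarrow> nat" where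
  "od t v = card {v' \<in> verts t. is_child v v'}"

definition adjacent :: "vertex \<Rightarrow> vertex \<Rightarrow> bool" where
  "adjacent u v \<longleftrightarrow> is_child u v \<or> is_child v u"

definition Aut :: "wtree \<Rightarrow> (vertex \<Rightarrow> vertex) set" where
  "Aut t = {f. f permutes verts t \<and> f [] = [] \<and>
     (\<forall>u\<in>verts t. \<forall>v\<in>verts t. adjacent (f u) (f v) \<longleftrightarrow> adjacent u v) \<and>
     (\<forall>v\<in>verts t. vweight t (f v) = vweight t v)}"

definition falling_factorial :: "real \<Rightarrow> nat \<Rightarrow> real" where
  "falling_factorial y k = (\<Prod>i<k. y - real i)"


section \<open>Binary tubings\<close>

definition is_tube :: "wtree \<Rightarrow> vertex set \<Rightarrow> bool" where
  "is_tube t T \<longleftrightarrow> T \<noteq> {} \<and> T \<subseteq> verts t \<and>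
     (\<forall>u\<in>T. \<forall>v\<in>T. (u, v) \<in> {(a, b). a \<in> T \<and> b \<in> T \<and> adjacent a b}\<^sup>*)"

text \<open>
  As usual for tubings, any two tubes are nested or disjoint. This has to be required: on the path
  with vertices \<open>a, b, c\<close> the union of the two binary tubings
  \<open>{abc, a, bc, b, c}\<close> and \<open>{abc, ab, c, a, b}\<close> satisfies all the other conditions.
\<close>

definition Tub :: "wtree \<Rightarrow> vertex set set set" where
  "Tub t = {\<tau>. (\<forall>T\<in>\<tau>. is_tube t T) \<and> verts t \<in> \<tau> \<and>
     (\<forall>A\<in>\<tau>. \<forall>B\<in>\<tau>. A \<subseteq> B \<or> B \<subseteq> A \<or> A \<inter> B = {}) \<and>
     (\<forall>T\<in>\<tau>. (\<exists>v. T = {v}) \<or>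
        (\<exists>A\<in>\<tau>. \<exists>B\<in>\<tau>. A \<noteq> T \<and> B \<noteq> T \<and> A \<inter> B = {} \<and> A \<union> B = T))}"

definition tube_root :: "vertex set \<Rightarrow> vertex \<Rightarrow> bool" where
  "tube_root T v \<longleftrightarrow> v \<in> T \<and> (\<forall>u\<in>T. length v \<le> length u)"

definition bstat :: "vertex \<Rightarrow> vertex set set \<Rightarrow> nat" where
  "bstat v \<tau> = card {T \<in> \<tau>. tube_root T v}"

text \<open>The coefficient \<open>c\<^bsub>i,k\<^esub>\<close> of \<open>\<rho>\<^bsup>i-1\<^esup>\<close> in \<open>F\<^sub>k\<close> is written \<open>c i k\<close>.\<close>

definition mellin_monomial :: "(nat \<Rightarrow> nat \<Rightarrow> real) \<Rightarrow> wtree \<Rightarrow> vertex set set \<Rightarrow> real" where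
  "mellin_monomial c t \<tau> = (\<Prod>v\<in>verts t - {[]}. c (bstat v \<tau> - 1) (vweight t v))"

definition phi :: "(nat \<Rightarrow> nat \<Rightarrow> real) \<Rightarrow> wtree \<Rightarrow> vertex set set \<Rightarrow> real poly" where
  "phi c t \<tau> = smult (mellin_monomial c t \<tau>)
     (\<Sum>i=1..bstat [] \<tau>. monom (c (bstat [] \<tau> - i) (vweight t []) / fact i) i)"

definition tree_coeff :: "real \<Rightarrow> wtree \<Rightarrow> real" where
  "tree_coeff s t =
     (\<Prod>v\<in>verts t. falling_factorial (1 + s * real (vweight t v)) (od t v)) / real (card (Aut t))"

end

theory Submission
  imports Defs "HOL-Library.Sublist" "HOL-Combinatorics.Multiset_Permutations"
begin

text \<open>
  The right-hand side of the Dyson--Schwinger equation applies to \<open>[x\<^sup>m] G\<^bsup>1+sk\<^esup>\<close> the linear operator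
  \<open>\<Lambda>\<^sub>k\<close> with \<open>\<Lambda>\<^sub>k (L\<^sup>j/j!) = \<Sum>i=1..j+1. c\<^bsub>j+1-i,k\<^esub> L\<^sup>i/i!\<close> (\<open>mellin_op\<close>), so that
  \<open>\<phi>\<^sub>L(\<tau>) = c(\<tau>) \<Lambda>\<^sub>k (L\<^bsup>b-1\<^esup>/(b-1)!)\<close> for \<open>b = b(\<tau>)\<close> and \<open>k\<close> the root weight. The combinatorial core is
  that \<open>P\<^sub>t = \<Sum>\<tau>. c(\<tau>) L\<^bsup>b-1\<^esup>/(b-1)!\<close> is the product of the \<open>\<Lambda> P\<^sub>u\<close> over the children \<open>u\<close> of the root.
  Since the outermost tube splits by cutting one edge, \<open>P\<^sub>t' = \<Sum>e. \<gamma>(t\<^sub>e) P\<^bsub>t-e\<^esub>\<close>, where \<open>t\<^sub>e\<close> is the part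
  below \<open>e\<close> and \<open>\<gamma>\<close> is the coefficient of \<open>L\<close> in \<open>\<Lambda> P\<close>. As \<open>(\<Lambda> p)' = \<Lambda> p' + [L\<^sup>1] \<Lambda> p\<close>, the product
  satisfies the same equation, and both sides agree at \<open>L = 0\<close>. Hence \<open>\<phi>\<^sub>L\<close> summed over tubings is
  multiplicative over grafting, and expanding \<open>G\<^bsup>1+sk\<^esup>\<close> into multisets of trees, counted by their
  automorphisms, yields the equation coefficientwise.
\<close>

subsection \<open>Mellin operators and tubings\<close>

text \<open>If \<open>a i\<close> is the coefficient of \<rho>^(i-1) in F, the inner sum is the
  coefficient of \<rho>^j in (e^(L \<rho>) - 1) F(\<rho>). The factor \<open>fact j\<close> comes
  from evaluating a j-th derivative at \<rho> = 0.\<close>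

definition mellin_op :: "(nat \<Rightarrow> real) \<Rightarrow> real poly \<Rightarrow> real poly" where
  "mellin_op a p = (\<Sum>j\<le>degree p. smult (coeff p j * fact j)
     (\<Sum>i=1..Suc j. monom (a (Suc j - i) / fact i) i))"

text \<open>A summation bound shared by several polynomials turns linearity into a termwise
  statement.\<close>

lemma mellin_op_degree_le:
  assumes "degree p \<le> N"
  shows "mellin_op a p = (\<Sum>j\<le>N. smult (coeff p j * fact j)
     (\<Sum>i=1..Suc j. monom (a (Suc j - i) / fact i) i))"
  unfolding mellin_op_def
  using assms by (intro sum.mono_neutral_left) (auto simp: coeff_eq_0)

lemma mellin_op_add: "mellin_op a (p + q) = mellin_op a p + mellin_op a q"
proof -
  define N where "N = max (degree p) (degree q)"
  have "degree (p + q) \<le> N" "degree p \<le> N" "degree q \<le> N"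
    unfolding N_def by (auto intro: degree_add_le_max)
  then show ?thesis
    by (simp add: mellin_op_degree_le[of _ N] sum.distrib smult_add_left algebra_simps)
qed

lemma smult_sum_right: "smult x (\<Sum>i\<in>A. f i) = (\<Sum>i\<in>A. smult x (f i))"
  by (induction A rule: infinite_finite_induct) (simp_all add: smult_add_right)

lemma mellin_op_smult: "mellin_op a (smult x p) = smult x (mellin_op a p)"
proof -
  have "degree (smult x p) \<le> degree p" by (rule degree_smult_le)
  then show ?thesis
    by (simp add: mellin_op_degree_le[of _ "degree p"] smult_sum_right mult.assoc)
qed

lemma mellin_op_0 [simp]: "mellin_op a 0 = 0"
  by (simp add: mellin_op_def)

lemma mellin_op_sum: "mellin_op a (\<Sum>x\<in>A. f x) = (\<Sum>x\<in>A. mellin_op a (f x))"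
  by (induction A rule: infinite_finite_induct) (simp_all add: mellin_op_add)

lemma mellin_op_monom:
  "mellin_op a (monom (x / fact j) j) =
     smult x (\<Sum>i=1..Suc j. monom (a (Suc j - i) / fact i) i)"
proof -
  have "mellin_op a (monom (x / fact j) j) = (\<Sum>l\<le>j. smult (coeff (monom (x / fact j) j) l * fact l)
     (\<Sum>i=1..Suc l. monom (a (Suc l - i) / fact i) i))"
    by (intro mellin_op_degree_le degree_monom_le)
  also have "\<dots> = (\<Sum>l\<in>{j}. smult (coeff (monom (x / fact j) j) l * fact l)
     (\<Sum>i=1..Suc l. monom (a (Suc l - i) / fact i) i))"
    by (intro sum.mono_neutral_right) auto
  finally show ?thesis by simp
qed

lemma coeff_mellin_op_0 [simp]: "coeff (mellin_op a p) 0 = 0"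
  by (simp add: mellin_op_def coeff_sum)

lemma coeff_mellin_op:
  assumes "degree p \<le> N"
  shows "coeff (mellin_op a p) (Suc n) = (\<Sum>j=n..N. coeff p j * fact j * a (j - n)) / fact (Suc n)"
proof -
  have "coeff (\<Sum>i=1..Suc j. monom (a (Suc j - i) / fact i) i) (Suc n) =
      (if n \<le> j then a (j - n) / fact (Suc n) else 0)" for j
  proof -
    have "coeff (\<Sum>i=1..Suc j. monom (a (Suc j - i) / fact i) i) (Suc n) =
        (\<Sum>i=1..Suc j. if i = Suc n then a (Suc j - i) / fact i else 0)"
      by (simp only: coeff_sum coeff_monom)
    then show ?thesis by (simp add: sum.delta)
  qed
  then have "coeff (mellin_op a p) (Suc n) =
      (\<Sum>j\<le>N. coeff p j * fact j * (if n \<le> j then a (j - n) / fact (Suc n) else 0))"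
    by (simp only: mellin_op_degree_le[OF assms] coeff_sum coeff_smult)
  also have "\<dots> = (\<Sum>j=n..N. coeff p j * fact j * (a (j - n) / fact (Suc n)))"
    by (intro sum.mono_neutral_cong_right) auto
  finally show ?thesis by (simp add: sum_divide_distrib)
qed

text \<open>Differentiation lowers every divided power L^i/i! by one. Applied to \<Lambda> (L^j/j!)
  it leaves the terms of \<Lambda> (L^(j-1)/(j-1)!) together with the constant \<open>a j\<close>,
  which was the coefficient of L before.\<close>

lemma pderiv_mellin_op:
  "pderiv (mellin_op a p) = mellin_op a (pderiv p) + [:coeff (mellin_op a p) 1:]"
proof (rule poly_eqI)
  fix n
  define N where "N = degree p"
  have N: "degree p \<le> Suc N" "degree (pderiv p) \<le> N"
    by (auto simp: N_def degree_pderiv)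
  show "coeff (pderiv (mellin_op a p)) n =
    coeff (mellin_op a (pderiv p) + [:coeff (mellin_op a p) 1:]) n"
  proof (cases n)
    case 0
    then show ?thesis by (simp add: coeff_pderiv)
  next
    case (Suc m)
    have "coeff (pderiv (mellin_op a p)) n =
        real (Suc n) * ((\<Sum>j=Suc m..Suc N. coeff p j * fact j * a (j - n)) / fact (Suc n))"
      using coeff_mellin_op[OF N(1), of a n] by (simp add: coeff_pderiv Suc)
    also have "\<dots> = (\<Sum>j=Suc m..Suc N. coeff p j * fact j * a (j - n)) / fact n"
      by (simp add: field_simps del: of_nat_Suc)
    \<comment> \<open>The factor produced by \<open>pderiv\<close> completes \<open>fact j\<close>
      to \<open>fact (Suc j)\<close>, so an index shift by one matches the two sums.\<close>
    also have "(\<Sum>j=Suc m..Suc N. coeff p j * fact j * a (j - n)) =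
        (\<Sum>j=m..N. coeff (pderiv p) j * fact j * a (j - m))"
      unfolding sum.shift_bounds_cl_Suc_ivl
      by (intro sum.cong) (simp_all add: coeff_pderiv Suc algebra_simps)
    finally show ?thesis
      using coeff_mellin_op[OF N(2), of a m] by (simp add: Suc)
  qed
qed

section \<open>Connected vertex sets with a topmost vertex\<close>

definition rooted :: "vertex \<Rightarrow> vertex set \<Rightarrow> bool" where
  "rooted r T \<longleftrightarrow> r \<in> T \<and> (\<forall>v\<in>T. prefix r v \<and> (\<forall>p. prefix r p \<and> prefix p v \<longrightarrow> p \<in> T))"

lemma rooted_mem: "rooted r T \<Longrightarrow> r \<in> T"
  and rooted_prefix: "rooted r T \<Longrightarrow> v \<in> T \<Longrightarrow> prefix r v"
  and rooted_between: "rooted r T \<Longrightarrow> v \<in> T \<Longrightarrow> prefix r p \<Longrightarrow> prefix p v \<Longrightarrow> p \<in> T"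
  unfolding rooted_def by blast+

lemma tube_root_rooted:
  assumes "rooted r T"
  shows "tube_root T v \<longleftrightarrow> v = r"
proof
  assume v: "tube_root T v"
  then have "prefix r v" "length v \<le> length r"
    using assms by (auto simp: tube_root_def rooted_def)
  then show "v = r" by (auto simp: prefix_def)
next
  assume "v = r"
  then show "tube_root T v"
    using assms by (auto simp: tube_root_def rooted_def prefix_length_le)
qed

lemma rooted_unique: "rooted r T \<Longrightarrow> rooted r' T \<Longrightarrow> r = r'"
  using tube_root_rooted[of r T r] tube_root_rooted[of r' T r] by simp

text \<open>Vertices are paths, so ancestors are prefixes. A nonempty set of vertices of a tree is
  connected exactly if it has a topmost vertex and contains the whole path from it to each member.
  This replaces reachability by a condition on prefixes.\<close>

lemma is_tube_iff_rooted: "is_tube t T \<longleftrightarrow> T \<subseteq> verts t \<and> (\<exists>r. rooted r T)"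
proof
  assume t: "is_tube t T"
  then obtain x where "x \<in> T" by (auto simp: is_tube_def)
  \<comment> \<open>Length is the distance from the root of the tree, so \<open>r\<close> is a
    member of least depth.\<close>
  define r where "r = arg_min_on length T"
  have r: "r \<in> T" "\<And>v. v \<in> T \<Longrightarrow> length r \<le> length v"
    using arg_min_nat_lemma[of "\<lambda>v. v \<in> T" x length] \<open>x \<in> T\<close>
    by (auto simp: r_def arg_min_on_def)
  \<comment> \<open>Induction along a walk from \<open>r\<close> inside \<open>T\<close>: a step
    down adds one new prefix, which itself lies in \<open>T\<close>, and a step up only drops
    one.\<close>
  have "prefix r v \<and> (\<forall>p. prefix r p \<and> prefix p v \<longrightarrow> p \<in> T)" if "v \<in> T" for v
  proof -
    have "(r, v) \<in> {(a, b). a \<in> T \<and> b \<in> T \<and> adjacent a b}\<^sup>*"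
      using t r that by (auto simp: is_tube_def)
    then show ?thesis
    proof (induction rule: rtrancl_induct)
      case base
      then show ?case using r(1) prefix_order.antisym by auto
    next
      case (step y z)
      then have yz: "y \<in> T" "z \<in> T" "adjacent y z" by auto
      then consider e where "z = y @ [e]" | e where "y = z @ [e]"
        by (auto simp: adjacent_def is_child_def)
      then show ?case
      proof cases
        case 1
        then show ?thesis using step.IH yz by (auto simp: prefix_snoc)
      next
        case 2
        \<comment> \<open>On a step up, \<open>y\<close> is longer than \<open>z\<close>, a member
          of \<open>T\<close>, so it is not of least depth; hence \<open>r\<close> is still a prefix
          of the parent \<open>z\<close>.\<close>
        have "r \<noteq> y" using r(2)[OF yz(2)] 2 by auto
        then show ?thesis using step.IH 2 by (auto simp: prefix_snoc)
      qed
    qed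
  qed
  then show "T \<subseteq> verts t \<and> (\<exists>r. rooted r T)"
    using t r(1) unfolding rooted_def is_tube_def by blast
next
  assume "T \<subseteq> verts t \<and> (\<exists>r. rooted r T)"
  then obtain r where T: "T \<subseteq> verts t" and r: "rooted r T" by auto
  define R where "R = {(a, b). a \<in> T \<and> b \<in> T \<and> adjacent a b}"
  have "sym R" by (auto simp: sym_def R_def adjacent_def)
  \<comment> \<open>Dropping the last path entry repeatedly leads from \<open>v\<close> up to
    \<open>r\<close> without leaving \<open>T\<close>.\<close>
  have *: "v \<in> T \<Longrightarrow> (r, v) \<in> R\<^sup>*" for v
  proof (induction v rule: rev_induct)
    case Nil
    then show ?case using rooted_prefix[OF r Nil] by simp
  next
    case (snoc e v)
    show ?case
    proof (cases "r = v @ [e]")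
      case False
      then have "prefix r v" using rooted_prefix[OF r snoc.prems] by (simp add: prefix_snoc)
      then have "v \<in> T" using rooted_between[OF r snoc.prems] by simp
      then have "(v, v @ [e]) \<in> R" using snoc.prems by (auto simp: R_def adjacent_def is_child_def)
      then show ?thesis using snoc.IH[OF \<open>v \<in> T\<close>] by (meson rtrancl.rtrancl_into_rtrancl)
    qed simp
  qed
  have "(u, v) \<in> R\<^sup>*" if "u \<in> T" "v \<in> T" for u v
    using *[OF that(1)] *[OF that(2)] \<open>sym R\<close> by (meson rtrancl_trans sym_rtrancl symD)
  then show "is_tube t T" using T rooted_mem[OF r] by (auto simp: is_tube_def R_def)
qed

section \<open>Binary tubings of arbitrary vertex sets\<close>

definition tubings :: "vertex set \<Rightarrow> vertex set set set" where
  "tubings T = {\<tau>. (\<forall>A\<in>\<tau>. A \<subseteq> T \<and> (\<exists>r. rooted r A)) \<and> T \<in> \<tau> \<and>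
     (\<forall>A\<in>\<tau>. \<forall>B\<in>\<tau>. A \<subseteq> B \<or> B \<subseteq> A \<or> A \<inter> B = {}) \<and>
     (\<forall>A\<in>\<tau>. (\<exists>v. A = {v}) \<or>
        (\<exists>B\<in>\<tau>. \<exists>C\<in>\<tau>. B \<noteq> A \<and> C \<noteq> A \<and> B \<inter> C = {} \<and> B \<union> C = A))}"

text \<open>The relative notion has no ambient tree, so the two pieces of a cut tube, which are not
  vertex sets of trees of type \<open>wtree\<close>, have tubings in the same sense.\<close>

lemma tubings_verts: "tubings (verts t) = Tub t"
  by (simp add: tubings_def Tub_def is_tube_iff_rooted)

lemma tubingsD:
  assumes "\<tau> \<in> tubings T"
  shows "T \<in> \<tau>"
    and "A \<in> \<tau> \<Longrightarrow> A \<subseteq> T"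
    and "A \<in> \<tau> \<Longrightarrow> \<exists>r. rooted r A"
    and "A \<in> \<tau> \<Longrightarrow> B \<in> \<tau> \<Longrightarrow> A \<subseteq> B \<or> B \<subseteq> A \<or> A \<inter> B = {}"
    and "A \<in> \<tau> \<Longrightarrow> (\<exists>v. A = {v}) \<or>
      (\<exists>B\<in>\<tau>. \<exists>C\<in>\<tau>. B \<noteq> A \<and> C \<noteq> A \<and> B \<inter> C = {} \<and> B \<union> C = A)"
  using assms by (simp_all add: tubings_def)

lemma finite_tubings: "finite T \<Longrightarrow> finite (tubings T)"
  using tubingsD(2) by (intro finite_subset[of "tubings T" "Pow (Pow T)"]) blast+

lemma finite_tubing: "finite T \<Longrightarrow> \<tau> \<in> tubings T \<Longrightarrow> finite \<tau>"
  using tubingsD(2) by (intro finite_subset[of \<tau> "Pow T"]) blast+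

lemma rooted_singleton: "rooted r {r}"
  by (auto simp: rooted_def intro: prefix_order.antisym)

lemma tubings_singleton: "tubings {r} = {{{r}}}"
proof
  have "\<tau> = {{r}}" if "\<tau> \<in> tubings {r}" for \<tau>
  proof -
    have "A = {r}" if "A \<in> \<tau>" for A
      using tubingsD(2,3)[OF \<open>\<tau> \<in> tubings {r}\<close> that] by (auto simp: rooted_def)
    then show ?thesis using tubingsD(1)[OF that] by blast
  qed
  then show "tubings {r} \<subseteq> {{{r}}}" by auto
  show "{{{r}}} \<subseteq> tubings {r}"
    using rooted_singleton[of r] by (auto simp: tubings_def)
qed

section \<open>Cutting a rooted set at the edge above a vertex\<close>

definition below :: "vertex \<Rightarrow> vertex set" where
  "below v = {u. prefix v u}"

lemma rooted_below:
  assumes "rooted r T" "v \<in> T"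
  shows "rooted v (T \<inter> below v)"
proof -
  have "p \<in> T \<inter> below v" if "u \<in> T" "prefix v p" "prefix p u" for u p
    using rooted_between[OF assms(1) that(1) _ that(3)] that(2)
      prefix_order.trans[OF rooted_prefix[OF assms] that(2)] by (simp add: below_def)
  then show ?thesis using assms(2) unfolding rooted_def by (auto simp: below_def)
qed

lemma rooted_Diff_below:
  assumes "rooted r T" "v \<in> T" "v \<noteq> r"
  shows "rooted r (T - below v)"
proof -
  have "r \<notin> below v"
    using rooted_prefix[OF assms(1,2)] assms(3) by (auto simp: below_def dest: prefix_order.antisym)
  moreover have "p \<in> T - below v" if "u \<in> T - below v" "prefix r p" "prefix p u" for u p
    using rooted_between[OF assms(1) _ that(2,3)] that prefix_order.trans[of v p u]
    by (auto simp: below_def)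
  ultimately show ?thesis
    using rooted_mem[OF assms(1)] rooted_prefix[OF assms(1)] unfolding rooted_def by blast
qed

text \<open>A descendant of \<open>v\<close> inside \<open>A\<close> would force \<open>v\<close>
  into \<open>A\<close>, since \<open>A\<close> contains the path from \<open>r\<close> to it. Thus
  a partition into two connected pieces amounts to cutting the edge above \<open>v\<close>.\<close>

lemma rooted_partition:
  assumes T: "rooted r T" and A: "rooted r A" and B: "rooted v B"
    and "A \<inter> B = {}" "A \<union> B = T"
  shows "v \<in> T - {r}" "B = T \<inter> below v" "A = T - below v"
proof -
  show v: "v \<in> T - {r}" using assms rooted_mem by blast
  have "u \<notin> A" if "u \<in> below v" for u
  proof
    assume "u \<in> A"
    then have "v \<in> A"
      using rooted_between[OF A \<open>u \<in> A\<close>] rooted_prefix[OF T] v that by (auto simp: below_def)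
    then show False using assms rooted_mem[OF B] by auto
  qed
  then show "B = T \<inter> below v" "A = T - below v"
    using rooted_prefix[OF B] assms(4,5) by (auto simp: below_def)
qed

text \<open>The two tubes that partition a tube inside \<open>A\<close> are subsets of it, hence
  survive the restriction.\<close>

lemma tubings_restrict:
  assumes "\<tau> \<in> tubings T" "A \<in> \<tau>"
  shows "{X \<in> \<tau>. X \<subseteq> A} \<in> tubings A"
proof -
  have "(\<exists>v. X = {v}) \<or> (\<exists>B\<in>{X \<in> \<tau>. X \<subseteq> A}. \<exists>C\<in>{X \<in> \<tau>. X \<subseteq> A}.
      B \<noteq> X \<and> C \<noteq> X \<and> B \<inter> C = {} \<and> B \<union> C = X)" if "X \<in> {X \<in> \<tau>. X \<subseteq> A}" for X
  proof -
    have "X \<in> \<tau>" "X \<subseteq> A" using that by auto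
    from tubingsD(5)[OF assms(1) this(1)] this(2) show ?thesis by blast
  qed
  moreover have "X \<subseteq> Y \<or> Y \<subseteq> X \<or> X \<inter> Y = {}" if "X \<in> \<tau>" "Y \<in> \<tau>" for X Y
    using tubingsD(4)[OF assms(1) that] .
  moreover have "\<exists>r. rooted r X" if "X \<in> \<tau>" for X
    using tubingsD(3)[OF assms(1) that] .
  ultimately show ?thesis using assms(2) unfolding tubings_def by blast
qed

text \<open>Here nestedness is decisive: a tube meeting both parts must contain both, so it is
  \<open>T\<close>.\<close>

lemma tubings_split:
  assumes \<tau>: "\<tau> \<in> tubings T" and AB: "A \<in> \<tau>" "B \<in> \<tau>" "A \<noteq> T" "B \<noteq> T" "A \<inter> B = {}" "A \<union> B = T"
  shows "\<tau> = insert T ({X \<in> \<tau>. X \<subseteq> A} \<union> {X \<in> \<tau>. X \<subseteq> B})"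
proof -
  have "X = T \<or> X \<subseteq> A \<or> X \<subseteq> B" if X: "X \<in> \<tau>" for X
  proof -
    have "X \<subseteq> T" using tubingsD(2)[OF \<tau> X] .
    moreover have "X \<subseteq> A \<or> A \<subseteq> X \<or> X \<inter> A = {}" "X \<subseteq> B \<or> B \<subseteq> X \<or> X \<inter> B = {}"
      using tubingsD(4)[OF \<tau> X AB(1)] tubingsD(4)[OF \<tau> X AB(2)] .
    ultimately show ?thesis using AB(5,6) by blast
  qed
  then show ?thesis using tubingsD(1)[OF \<tau>] by blast
qed

lemma tubings_join:
  assumes T: "rooted r T" and AB: "A \<noteq> T" "B \<noteq> T" "A \<inter> B = {}" "A \<union> B = T"
    and \<alpha>: "\<alpha> \<in> tubings A" and \<beta>: "\<beta> \<in> tubings B"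
  shows "insert T (\<alpha> \<union> \<beta>) \<in> tubings T"
proof -
  let ?\<tau> = "insert T (\<alpha> \<union> \<beta>)"
  have sub: "X \<subseteq> A" if "X \<in> \<alpha>" for X using tubingsD(2)[OF \<alpha> that] .
  have sub': "X \<subseteq> B" if "X \<in> \<beta>" for X using tubingsD(2)[OF \<beta> that] .
  have "X \<subseteq> T \<and> (\<exists>r. rooted r X)" if "X \<in> ?\<tau>" for X
    using that T AB sub sub' tubingsD(3)[OF \<alpha>, of X] tubingsD(3)[OF \<beta>, of X] by blast
  moreover have "X \<subseteq> Y \<or> Y \<subseteq> X \<or> X \<inter> Y = {}" if XY: "X \<in> ?\<tau>" "Y \<in> ?\<tau>" for X Y
  proof -
    have XT: "X \<subseteq> T" "Y \<subseteq> T" using XY AB(4) sub sub' by blast+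
    consider "X = T \<or> Y = T" | "X \<in> \<alpha>" "Y \<in> \<alpha>" | "X \<in> \<beta>" "Y \<in> \<beta>"
      | "X \<in> \<alpha>" "Y \<in> \<beta>" | "X \<in> \<beta>" "Y \<in> \<alpha>"
      using XY by blast
    then show ?thesis
    proof cases
      case 1
      then show ?thesis using XT by blast
    next
      case 2
      then show ?thesis by (rule tubingsD(4)[OF \<alpha>])
    next
      case 3
      then show ?thesis by (rule tubingsD(4)[OF \<beta>])
    next
      case 4
      then show ?thesis using sub[of X] sub'[of Y] AB(3) by blast
    next
      case 5
      then show ?thesis using sub[of Y] sub'[of X] AB(3) by blast
    qed
  qed
  moreover have "(\<exists>v. X = {v}) \<or>
      (\<exists>B\<in>?\<tau>. \<exists>C\<in>?\<tau>. B \<noteq> X \<and> C \<noteq> X \<and> B \<inter> C = {} \<and> B \<union> C = X)" if "X \<in> ?\<tau>" for X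
  proof -
    consider "X = T" | "X \<in> \<alpha>" | "X \<in> \<beta>" using \<open>X \<in> ?\<tau>\<close> by blast
    then show ?thesis
    proof cases
      case 1
      then show ?thesis using AB tubingsD(1)[OF \<alpha>] tubingsD(1)[OF \<beta>] by blast
    next
      case 2
      then show ?thesis using tubingsD(5)[OF \<alpha> 2] by blast
    next
      case 3
      then show ?thesis using tubingsD(5)[OF \<beta> 3] by blast
    qed
  qed
  ultimately show ?thesis unfolding tubings_def
    by (intro CollectI conjI ballI) simp_all
qed

text \<open>Recovers both factors from the joined tubing. Tubes are nonempty, so none can lie in
  both of the disjoint parts.\<close>

lemma tubings_join_restrict:
  assumes AB: "A \<noteq> T" "B \<noteq> T" "A \<inter> B = {}" "A \<union> B = T"
    and \<alpha>: "\<alpha> \<in> tubings A" and \<beta>: "\<beta> \<in> tubings B"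
  shows "{X \<in> insert T (\<alpha> \<union> \<beta>). X \<subseteq> A} = \<alpha>" "{X \<in> insert T (\<alpha> \<union> \<beta>). X \<subseteq> B} = \<beta>"
proof -
  have ne: "X \<noteq> {}" if "X \<in> \<alpha> \<or> X \<in> \<beta>" for X
    using that tubingsD(3)[OF \<alpha>] tubingsD(3)[OF \<beta>] by (auto simp: rooted_def)
  have sub: "X \<subseteq> A" if "X \<in> \<alpha>" for X using tubingsD(2)[OF \<alpha> that] .
  have sub': "X \<subseteq> B" if "X \<in> \<beta>" for X using tubingsD(2)[OF \<beta> that] .
  have T: "\<not> T \<subseteq> A" "\<not> T \<subseteq> B" using AB by blast+
  have "\<not> X \<subseteq> B" if "X \<in> \<alpha>" for X using ne[of X] sub[OF that] that AB(3) by blast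
  moreover have "\<not> X \<subseteq> A" if "X \<in> \<beta>" for X using ne[of X] sub'[OF that] that AB(3) by blast
  ultimately show "{X \<in> insert T (\<alpha> \<union> \<beta>). X \<subseteq> A} = \<alpha>" "{X \<in> insert T (\<alpha> \<union> \<beta>). X \<subseteq> B} = \<beta>"
    using T sub sub' by blast+
qed

text \<open>The outermost tube splits into two connected pieces, that is, along one edge, which is
  labelled by its lower end \<open>v\<close>. What remains is an independent tubing of each
  piece.\<close>

lemma bij_betw_tubings:
  assumes T: "rooted r T" and "T \<noteq> {r}"
  shows "bij_betw (\<lambda>(v, \<alpha>, \<beta>). insert T (\<alpha> \<union> \<beta>))
    (SIGMA v:T - {r}. tubings (T - below v) \<times> tubings (T \<inter> below v)) (tubings T)"
proof -
  have cut: "T - below v \<noteq> T" "T \<inter> below v \<noteq> T" "(T - below v) \<inter> (T \<inter> below v) = {}"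
    "(T - below v) \<union> (T \<inter> below v) = T" if "v \<in> T - {r}" for v
  proof -
    have "v \<in> below v" "v \<in> T" using that by (auto simp: below_def)
    moreover have "r \<in> T - below v"
      using rooted_mem[OF rooted_Diff_below[OF T]] that by auto
    ultimately show "T - below v \<noteq> T" "T \<inter> below v \<noteq> T" by blast+
  qed blast+
  show ?thesis
    unfolding bij_betw_def
  proof (intro conjI)
    show "inj_on (\<lambda>(v, \<alpha>, \<beta>). insert T (\<alpha> \<union> \<beta>))
      (SIGMA v:T - {r}. tubings (T - below v) \<times> tubings (T \<inter> below v))"
    proof (rule inj_onI)
      fix x y
      assume x: "x \<in> (SIGMA v:T - {r}. tubings (T - below v) \<times> tubings (T \<inter> below v))"
        and y: "y \<in> (SIGMA v:T - {r}. tubings (T - below v) \<times> tubings (T \<inter> below v))"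
        and xy: "(\<lambda>(v, \<alpha>, \<beta>). insert T (\<alpha> \<union> \<beta>)) x = (\<lambda>(v, \<alpha>, \<beta>). insert T (\<alpha> \<union> \<beta>)) y"
      obtain v \<alpha> \<beta> where x_eq: "x = (v, \<alpha>, \<beta>)" by (cases x)
      obtain v' \<alpha>' \<beta>' where y_eq: "y = (v', \<alpha>', \<beta>')" by (cases y)
      have v: "v \<in> T" "v \<noteq> r" and v': "v' \<in> T" "v' \<noteq> r"
        and ab: "\<alpha> \<in> tubings (T - below v)" "\<beta> \<in> tubings (T \<inter> below v)"
        and ab': "\<alpha>' \<in> tubings (T - below v')" "\<beta>' \<in> tubings (T \<inter> below v')"
        and eq: "insert T (\<alpha> \<union> \<beta>) = insert T (\<alpha>' \<union> \<beta>')"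
        using x y xy by (simp_all add: x_eq y_eq)
      have c: "T - below v \<noteq> T" "T \<inter> below v \<noteq> T" "T - below v' \<noteq> T" "T \<inter> below v' \<noteq> T"
        using cut v v' by auto
      have rA: "r \<in> T - below v" "r \<in> T - below v'"
        using rooted_mem[OF rooted_Diff_below[OF T]] v v' by auto
      have "T \<inter> below v' \<in> insert T (\<alpha> \<union> \<beta>)" "T - below v' \<in> insert T (\<alpha> \<union> \<beta>)"
        unfolding eq using tubingsD(1)[OF ab'(1)] tubingsD(1)[OF ab'(2)] by blast+
      then have "T \<inter> below v' \<in> \<alpha> \<union> \<beta>" "T - below v' \<in> \<alpha> \<union> \<beta>"
        using c(3,4) by blast+
      \<comment> \<open>Both parts of the second cut are tubes of the first tubing. As
        \<open>r\<close> lies in both upper parts, upper is contained in upper and lower in lower,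
        and complementation gives equality.\<close>
      then have "T - below v' \<subseteq> T - below v \<or> T - below v' \<subseteq> T \<inter> below v"
        "T \<inter> below v' \<subseteq> T - below v \<or> T \<inter> below v' \<subseteq> T \<inter> below v"
        using tubingsD(2)[OF ab(1)] tubingsD(2)[OF ab(2)] by blast+
      then have eqb: "T \<inter> below v' = T \<inter> below v" "T - below v' = T - below v"
        using rA c by blast+
      have "v = v'"
        using rooted_unique[OF rooted_below[OF T v(1)]] rooted_below[OF T v'(1)] eqb by simp
      moreover have "\<alpha> = \<alpha>'" "\<beta> = \<beta>'"
        using tubings_join_restrict[OF c(1,2) cut(3,4) ab] v
          tubings_join_restrict[OF c(3,4) cut(3,4) ab', folded eq, unfolded eqb] v' by simp_all
      ultimately show "x = y" by (simp add: x_eq y_eq)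
    qed
    show "(\<lambda>(v, \<alpha>, \<beta>). insert T (\<alpha> \<union> \<beta>)) `
      (SIGMA v:T - {r}. tubings (T - below v) \<times> tubings (T \<inter> below v)) = tubings T"
    proof (intro equalityI subsetI)
      fix \<tau> assume \<tau>: "\<tau> \<in> tubings T"
      have "\<not> (\<exists>v. T = {v})" using \<open>T \<noteq> {r}\<close> rooted_mem[OF T] by auto
      then obtain B C where BC: "B \<in> \<tau>" "C \<in> \<tau>" "B \<noteq> T" "C \<noteq> T" "B \<inter> C = {}" "B \<union> C = T"
        using tubingsD(5)[OF \<tau> tubingsD(1)[OF \<tau>]] by blast
      \<comment> \<open>The definition does not order the two parts; \<open>A\<close> is chosen to
        be the one containing \<open>r\<close>.\<close>
      obtain A B where AB: "A \<in> \<tau>" "B \<in> \<tau>" "A \<noteq> T" "B \<noteq> T" "A \<inter> B = {}" "A \<union> B = T" "r \<in> A"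
      proof (cases "r \<in> B")
        case True
        then show ?thesis using that BC by blast
      next
        case False
        moreover have "r \<in> B \<union> C" using rooted_mem[OF T] BC(6) by simp
        moreover have "C \<inter> B = {}" "C \<union> B = T" using BC by auto
        ultimately show ?thesis using that BC(1-4) by blast
      qed
      obtain r' where r': "rooted r' A" using tubingsD(3)[OF \<tau> AB(1)] by blast
      have "r' \<in> T" using rooted_mem[OF r'] AB by auto
      then have "r' = r"
        using rooted_prefix[OF r' AB(7)] rooted_prefix[OF T] prefix_order.antisym by blast
      then have rA: "rooted r A" using r' by simp
      obtain v where rB: "rooted v B" using tubingsD(3)[OF \<tau> AB(2)] by blast
      note p = rooted_partition[OF T rA rB AB(5,6)]
      have "\<tau> = insert T ({X \<in> \<tau>. X \<subseteq> A} \<union> {X \<in> \<tau>. X \<subseteq> B})"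
        by (rule tubings_split[OF \<tau> AB(1-6)])
      moreover have "{X \<in> \<tau>. X \<subseteq> A} \<in> tubings (T - below v)" "{X \<in> \<tau>. X \<subseteq> B} \<in> tubings (T \<inter> below v)"
        using tubings_restrict[OF \<tau> AB(1)] tubings_restrict[OF \<tau> AB(2)] p by auto
      ultimately show "\<tau> \<in> (\<lambda>(v, \<alpha>, \<beta>). insert T (\<alpha> \<union> \<beta>)) `
          (SIGMA v:T - {r}. tubings (T - below v) \<times> tubings (T \<inter> below v))"
        using p(1) by (intro image_eqI[of _ _ "(v, {X \<in> \<tau>. X \<subseteq> A}, {X \<in> \<tau>. X \<subseteq> B})"]) auto
    next
      fix \<tau> assume "\<tau> \<in> (\<lambda>(v, \<alpha>, \<beta>). insert T (\<alpha> \<union> \<beta>)) `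
          (SIGMA v:T - {r}. tubings (T - below v) \<times> tubings (T \<inter> below v))"
      then obtain v \<alpha> \<beta> where "v \<in> T - {r}" "\<alpha> \<in> tubings (T - below v)"
          "\<beta> \<in> tubings (T \<inter> below v)" "\<tau> = insert T (\<alpha> \<union> \<beta>)"
        by blast
      then show "\<tau> \<in> tubings T" using tubings_join[OF T cut(1,2) cut(3,4)] by simp
    qed
  qed
qed

subsection \<open>The tubing polynomial\<close>

text \<open>Ensures that the natural subtraction in \<open>bstat r \<tau> - 1\<close> does not
  truncate.\<close>

lemma bstat_root_pos:
  assumes "finite T" "\<tau> \<in> tubings T" "rooted r T"
  shows "0 < bstat r \<tau>"
proof -
  have "T \<in> {X \<in> \<tau>. tube_root X r}"
    using tubingsD(1)[OF assms(2)] tube_root_rooted[OF assms(3)] by simp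
  moreover have "finite {X \<in> \<tau>. tube_root X r}" using finite_tubing[OF assms(1,2)] by simp
  ultimately show ?thesis unfolding bstat_def by (metis card_gt_0_iff empty_iff)
qed

text \<open>The only tube added to \<alpha> and \<beta> is \<open>T\<close>, whose root is
  \<open>r\<close>, so only the statistic of \<open>r\<close> grows. A tube contains its root, so a
  vertex is never counted by tubes of the opposite part.\<close>

lemma bstat_join:
  assumes T: "finite T" "rooted r T" and AB: "A \<noteq> T" "A \<inter> B = {}" "A \<union> B = T" "r \<in> A"
    and \<alpha>: "\<alpha> \<in> tubings A" and \<beta>: "\<beta> \<in> tubings B"
  shows "bstat r (insert T (\<alpha> \<union> \<beta>)) = Suc (bstat r \<alpha>)"
    and "u \<in> A - {r} \<Longrightarrow> bstat u (insert T (\<alpha> \<union> \<beta>)) = bstat u \<alpha>"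
    and "u \<in> B \<Longrightarrow> bstat u (insert T (\<alpha> \<union> \<beta>)) = bstat u \<beta>"
proof -
  have sub: "X \<subseteq> A" if "X \<in> \<alpha>" for X using tubingsD(2)[OF \<alpha> that] .
  have sub': "X \<subseteq> B" if "X \<in> \<beta>" for X using tubingsD(2)[OF \<beta> that] .
  have root: "tube_root X u \<Longrightarrow> u \<in> X" for X u by (simp add: tube_root_def)
  have "T \<notin> \<alpha>" using sub AB by blast
  have fin: "finite \<alpha>" using finite_tubing[OF _ \<alpha>] T(1) AB(3) by blast
  have "{X \<in> insert T (\<alpha> \<union> \<beta>). tube_root X r} = insert T {X \<in> \<alpha>. tube_root X r}"
    using sub' root[of _ r] AB tube_root_rooted[OF T(2), of r] by blast
  then show "bstat r (insert T (\<alpha> \<union> \<beta>)) = Suc (bstat r \<alpha>)"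
    using \<open>T \<notin> \<alpha>\<close> fin by (simp add: bstat_def)
  show "bstat u (insert T (\<alpha> \<union> \<beta>)) = bstat u \<alpha>" if "u \<in> A - {r}"
  proof -
    have "{X \<in> insert T (\<alpha> \<union> \<beta>). tube_root X u} = {X \<in> \<alpha>. tube_root X u}"
      using sub' root[of _ u] AB tube_root_rooted[OF T(2), of u] that by blast
    then show ?thesis by (simp add: bstat_def)
  qed
  show "bstat u (insert T (\<alpha> \<union> \<beta>)) = bstat u \<beta>" if "u \<in> B"
  proof -
    have "u \<noteq> r" using that AB by blast
    then have "{X \<in> insert T (\<alpha> \<union> \<beta>). tube_root X u} = {X \<in> \<beta>. tube_root X u}"
      using sub root[of _ u] AB tube_root_rooted[OF T(2), of u] that by blast
    then show ?thesis by (simp add: bstat_def)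
  qed
qed

definition nonroot_weight ::
  "(nat \<Rightarrow> nat \<Rightarrow> real) \<Rightarrow> (vertex \<Rightarrow> nat) \<Rightarrow> vertex \<Rightarrow> vertex set \<Rightarrow> vertex set set \<Rightarrow> real" where
  "nonroot_weight c w r T \<tau> = (\<Prod>v\<in>T - {r}. c (bstat v \<tau> - 1) (w v))"

text \<open>This is the polynomial P of the overview; \<open>tub_const\<close> below is \<gamma> and
  \<open>tub_mellin\<close> is \<Lambda> P. The weight is a free function \<open>w\<close>, which
  allows transport to subtrees.\<close>

definition tub_poly ::
  "(nat \<Rightarrow> nat \<Rightarrow> real) \<Rightarrow> (vertex \<Rightarrow> nat) \<Rightarrow> vertex \<Rightarrow> vertex set \<Rightarrow> real poly" where
  "tub_poly c w r T =
     (\<Sum>\<tau>\<in>tubings T. monom (nonroot_weight c w r T \<tau> / fact (bstat r \<tau> - 1)) (bstat r \<tau> - 1))"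

definition tub_const :: "(nat \<Rightarrow> nat \<Rightarrow> real) \<Rightarrow> (vertex \<Rightarrow> nat) \<Rightarrow> vertex set \<Rightarrow> real" where
  "tub_const c w T = (\<Sum>\<tau>\<in>tubings T. \<Prod>v\<in>T. c (bstat v \<tau> - 1) (w v))"

definition tub_mellin ::
  "(nat \<Rightarrow> nat \<Rightarrow> real) \<Rightarrow> (vertex \<Rightarrow> nat) \<Rightarrow> vertex \<Rightarrow> vertex set \<Rightarrow> real poly" where
  "tub_mellin c w r T = mellin_op (\<lambda>i. c i (w r)) (tub_poly c w r T)"

lemma tub_poly_singleton [simp]: "tub_poly c w r {r} = 1"
proof -
  have "{T. T = {r} \<and> tube_root T r} = {{r}}" by (auto simp: tube_root_def)
  then have "bstat r {{r}} = 1" by (simp add: bstat_def)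
  then show ?thesis by (simp add: tub_poly_def tubings_singleton nonroot_weight_def)
qed

text \<open>\<Lambda> sends L^(b-1)/(b-1)! to the sum with upper limit b that occurs in \<phi>, so
  \<Lambda> P is the sum of \<phi> over all tubings.\<close>

lemma tub_mellin_altdef:
  assumes "finite T" "rooted r T"
  shows "tub_mellin c w r T = (\<Sum>\<tau>\<in>tubings T. smult (nonroot_weight c w r T \<tau>)
    (\<Sum>i=1..bstat r \<tau>. monom (c (bstat r \<tau> - i) (w r) / fact i) i))"
  unfolding tub_mellin_def tub_poly_def mellin_op_sum mellin_op_monom
  using bstat_root_pos[OF assms(1) _ assms(2)] by (intro sum.cong) simp_all

text \<open>The term i = 1 supplies exactly the factor of the root that
  \<open>nonroot_weight\<close> leaves out.\<close>

lemma coeff_1_tub_mellin: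
  assumes "finite T" "rooted r T"
  shows "coeff (tub_mellin c w r T) 1 = tub_const c w T"
proof -
  have "coeff (smult (nonroot_weight c w r T \<tau>)
      (\<Sum>i=1..bstat r \<tau>. monom (c (bstat r \<tau> - i) (w r) / fact i) i)) 1 =
      (\<Prod>v\<in>T. c (bstat v \<tau> - 1) (w v))" if "\<tau> \<in> tubings T" for \<tau>
  proof -
    have "coeff (\<Sum>i=1..bstat r \<tau>. monom (c (bstat r \<tau> - i) (w r) / fact i) i) 1 =
        (\<Sum>i=1..bstat r \<tau>. if i = 1 then c (bstat r \<tau> - i) (w r) / fact i else 0)"
      by (simp only: coeff_sum coeff_monom)
    also have "\<dots> = c (bstat r \<tau> - 1) (w r)"
      using bstat_root_pos[OF assms(1) that assms(2)] by (simp add: sum.delta)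
    finally show ?thesis
      using assms rooted_mem[OF assms(2)]
      by (simp add: nonroot_weight_def prod.remove[of T r] mult.commute)
  qed
  then show ?thesis
    unfolding tub_mellin_altdef[OF assms] coeff_sum tub_const_def by (rule sum.cong[OF refl])
qed

lemma tubing_cut:
  assumes "rooted r T" "v \<in> T - {r}"
  shows "rooted r (T - below v)" "rooted v (T \<inter> below v)" "r \<in> T - below v"
    "T - below v \<noteq> T" "T \<inter> below v \<noteq> T" "v \<in> T \<inter> below v"
proof -
  show A: "rooted r (T - below v)" and B: "rooted v (T \<inter> below v)"
    using assms rooted_Diff_below rooted_below by auto
  show "r \<in> T - below v" "v \<in> T \<inter> below v" using rooted_mem[OF A] rooted_mem[OF B] .
  then show "T - below v \<noteq> T" "T \<inter> below v \<noteq> T" by blast+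
qed

lemma sum_tubings:
  assumes "finite T" "rooted r T" "T \<noteq> {r}"
  shows "(\<Sum>\<tau>\<in>tubings T. f \<tau>) = (\<Sum>v\<in>T - {r}. \<Sum>\<alpha>\<in>tubings (T - below v). \<Sum>\<beta>\<in>tubings (T \<inter> below v).
    f (insert T (\<alpha> \<union> \<beta>)))"
proof -
  have "(\<Sum>\<tau>\<in>tubings T. f \<tau>) =
      (\<Sum>(v, \<alpha>, \<beta>)\<in>(SIGMA v:T - {r}. tubings (T - below v) \<times> tubings (T \<inter> below v)).
        f (insert T (\<alpha> \<union> \<beta>)))"
    using sum.reindex_bij_betw[OF bij_betw_tubings[OF assms(2,3)], of f, symmetric]
    by (simp add: case_prod_unfold)
  also have "\<dots> = (\<Sum>v\<in>T - {r}. \<Sum>(\<alpha>, \<beta>)\<in>tubings (T - below v) \<times> tubings (T \<inter> below v).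
        f (insert T (\<alpha> \<union> \<beta>)))"
    using assms(1) by (subst sum.Sigma) (auto simp: finite_tubings)
  also have "\<dots> = (\<Sum>v\<in>T - {r}. \<Sum>\<alpha>\<in>tubings (T - below v). \<Sum>\<beta>\<in>tubings (T \<inter> below v).
        f (insert T (\<alpha> \<union> \<beta>)))"
    by (simp add: sum.cartesian_product)
  finally show ?thesis .
qed

text \<open>With a second vertex present, \<open>r\<close> is the root of \<open>T\<close> and also
  of the upper part, so its statistic is at least 2 and no constant term arises.\<close>

lemma coeff_0_tub_poly:
  assumes "finite T" "rooted r T" "T \<noteq> {r}"
  shows "coeff (tub_poly c w r T) 0 = 0"
proof -
  have "bstat r (insert T (\<alpha> \<union> \<beta>)) - Suc 0 \<noteq> 0"
    if "v \<in> T - {r}" "\<alpha> \<in> tubings (T - below v)" "\<beta> \<in> tubings (T \<inter> below v)" for v \<alpha> \<beta>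
  proof -
    note cut = tubing_cut[OF assms(2) that(1)]
    have "bstat r (insert T (\<alpha> \<union> \<beta>)) = Suc (bstat r \<alpha>)"
      using bstat_join(1)[OF assms(1,2) cut(4) _ _ cut(3) that(2,3)] by blast
    then show ?thesis using bstat_root_pos[OF _ that(2) cut(1)] assms(1) by simp
  qed
  then show ?thesis
    unfolding tub_poly_def coeff_sum sum_tubings[OF assms] by (intro sum.neutral ballI) simp
qed

lemma pderiv_sum: "pderiv (\<Sum>x\<in>A. f x) = (\<Sum>x\<in>A. pderiv (f x))"
  by (induction A rule: infinite_finite_induct) (simp_all add: pderiv_add)

text \<open>Differentiating L^(b-1)/(b-1)! lowers b by one, which is the effect of deleting the
  outermost tube. The upper part keeps its own root \<open>r\<close>, while every vertex of the
  lower part, including its root, contributes a factor; hence \<open>tub_const\<close>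
  there.\<close>

lemma pderiv_tub_poly:
  assumes "finite T" "rooted r T"
  shows "pderiv (tub_poly c w r T) =
    (\<Sum>v\<in>T - {r}. smult (tub_const c w (T \<inter> below v)) (tub_poly c w r (T - below v)))"
proof (cases "T = {r}")
  case False
  define f where "f \<tau> = monom (nonroot_weight c w r T \<tau> / fact (bstat r \<tau> - 1)) (bstat r \<tau> - 1)" for \<tau>
  have f: "pderiv (f (insert T (\<alpha> \<union> \<beta>))) =
      smult (\<Prod>v\<in>T \<inter> below v. c (bstat v \<beta> - 1) (w v))
        (monom (nonroot_weight c w r (T - below v) \<alpha> / fact (bstat r \<alpha> - 1)) (bstat r \<alpha> - 1))"
    if "v \<in> T - {r}" "\<alpha> \<in> tubings (T - below v)" "\<beta> \<in> tubings (T \<inter> below v)" for v \<alpha> \<beta>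
  proof -
    note cut = tubing_cut[OF assms(2) that(1)]
    let ?A = "T - below v" and ?B = "T \<inter> below v"
    have AB: "?A \<inter> ?B = {}" "?A \<union> ?B = T" by blast+
    note b = bstat_join[OF assms(1,2) cut(4) AB cut(3) that(2,3)]
    have "0 < bstat r \<alpha>" using bstat_root_pos[OF _ that(2) cut(1)] assms(1) by simp
    then obtain n where n: "bstat r \<alpha> = Suc n" by (auto simp: gr0_conv_Suc)
    \<comment> \<open>The root \<open>v\<close> of the lower part is not the root of
      \<open>T\<close>, so the whole lower part enters the product.\<close>
    have "T - {r} = (?A - {r}) \<union> ?B" "(?A - {r}) \<inter> ?B = {}" using cut(3) by blast+
    then have "nonroot_weight c w r T (insert T (\<alpha> \<union> \<beta>)) =
        (\<Prod>v\<in>?A - {r}. c (bstat v (insert T (\<alpha> \<union> \<beta>)) - 1) (w v)) *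
        (\<Prod>v\<in>?B. c (bstat v (insert T (\<alpha> \<union> \<beta>)) - 1) (w v))"
      unfolding nonroot_weight_def using assms(1) by (simp add: prod.union_disjoint)
    also have "(\<Prod>v\<in>?A - {r}. c (bstat v (insert T (\<alpha> \<union> \<beta>)) - 1) (w v)) =
        nonroot_weight c w r ?A \<alpha>"
      unfolding nonroot_weight_def by (intro prod.cong refl) (simp only: b(2))
    also have "(\<Prod>v\<in>?B. c (bstat v (insert T (\<alpha> \<union> \<beta>)) - 1) (w v)) =
        (\<Prod>v\<in>?B. c (bstat v \<beta> - 1) (w v))"
      by (intro prod.cong refl) (simp only: b(3))
    finally show ?thesis
      by (simp add: f_def b(1) n pderiv_monom smult_monom del: of_nat_Suc)
  qed
  have "pderiv (tub_poly c w r T) = (\<Sum>v\<in>T - {r}. \<Sum>\<alpha>\<in>tubings (T - below v).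
      \<Sum>\<beta>\<in>tubings (T \<inter> below v). pderiv (f (insert T (\<alpha> \<union> \<beta>))))"
    unfolding tub_poly_def f_def[symmetric] sum_tubings[OF assms False] pderiv_sum ..
  also have "\<dots> = (\<Sum>v\<in>T - {r}. \<Sum>\<alpha>\<in>tubings (T - below v). \<Sum>\<beta>\<in>tubings (T \<inter> below v).
      smult (\<Prod>v\<in>T \<inter> below v. c (bstat v \<beta> - 1) (w v))
        (monom (nonroot_weight c w r (T - below v) \<alpha> / fact (bstat r \<alpha> - 1)) (bstat r \<alpha> - 1)))"
    by (intro sum.cong refl f)
  also have "\<dots> = (\<Sum>v\<in>T - {r}. smult (tub_const c w (T \<inter> below v)) (tub_poly c w r (T - below v)))"
    unfolding tub_const_def tub_poly_def smult_sum_right smult_sum ..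
  finally show ?thesis .
qed simp

section \<open>Branches at the root and the product formula\<close>

definition child_verts :: "vertex \<Rightarrow> vertex set \<Rightarrow> vertex set" where
  "child_verts r T = {v \<in> T. is_child r v}"

lemma below_child_disjoint:
  assumes "is_child r v" "is_child r v'" "v \<noteq> v'"
  shows "below v \<inter> below v' = {}"
  using assms by (auto simp: is_child_def below_def prefix_def)

lemma rooted_Diff_root:
  assumes "rooted r T"
  shows "T - {r} = (\<Union>v\<in>child_verts r T. T \<inter> below v)"
proof (intro equalityI subsetI)
  fix u assume u: "u \<in> T - {r}"
  then obtain q where q: "u = r @ q" "q \<noteq> []"
    using rooted_prefix[OF assms, of u] by (auto simp: prefix_def)
  then obtain e p where p: "u = r @ e # p" by (cases q) simp_all
  then have "r @ [e] \<in> T" using rooted_between[OF assms, of u "r @ [e]"] u by simp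
  then show "u \<in> (\<Union>v\<in>child_verts r T. T \<inter> below v)"
    using u p by (auto simp: child_verts_def is_child_def below_def)
next
  fix u assume "u \<in> (\<Union>v\<in>child_verts r T. T \<inter> below v)"
  then show "u \<in> T - {r}" by (auto simp: child_verts_def is_child_def below_def)
qed

lemma poly_eq_of_pderiv_eq:
  fixes p q :: "real poly"
  assumes "pderiv p = pderiv q" "coeff p 0 = coeff q 0"
  shows "p = q"
proof (rule poly_eqI)
  fix n
  show "coeff p n = coeff q n"
  proof (cases n)
    case (Suc m)
    have "coeff (pderiv p) m = coeff (pderiv q) m" using assms(1) by simp
    then show ?thesis by (simp add: coeff_pderiv Suc del: of_nat_Suc)
  qed (simp add: assms(2))
qed

text \<open>The constant can be read as the cut above \<open>r\<close> itself, which separates all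
  of \<open>T\<close>. In a larger tree where \<open>r\<close> is a child of the root, it accounts
  for the edge leading to \<open>r\<close>.\<close>

lemma pderiv_tub_mellin:
  assumes "finite T" "rooted r T"
  shows "pderiv (tub_mellin c w r T) = [:tub_const c w T:] +
    (\<Sum>u\<in>T - {r}. smult (tub_const c w (T \<inter> below u)) (tub_mellin c w r (T - below u)))"
  unfolding tub_mellin_def pderiv_mellin_op pderiv_tub_poly[OF assms] mellin_op_sum mellin_op_smult
    coeff_1_tub_mellin[OF assms, unfolded tub_mellin_def] by simp

text \<open>Both sides have the same derivative: on the right, the Leibniz rule and the renormalization
  group equation \<open>pderiv_tub_mellin\<close> also produce a sum over all edges of \<open>T\<close>.\<close>

theorem tub_poly_eq_prod:
  assumes "finite T" "rooted r T"
  shows "tub_poly c w r T = (\<Prod>v\<in>child_verts r T. tub_mellin c w v (T \<inter> below v))"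
  using assms
proof (induction "card T" arbitrary: T rule: less_induct)
  case less
  note fin = less.prems(1) and root = less.prems(2)
  let ?ch = "child_verts r T" and ?\<phi> = "tub_mellin c w"
  show ?case
  proof (cases "T = {r}")
    case True
    then have "?ch = {}" by (auto simp: child_verts_def is_child_def)
    then show ?thesis using True by simp
  next
    case False
    have finch: "finite ?ch" using fin by (simp add: child_verts_def)
    have ch: "v \<in> T - {r}" "is_child r v" if "v \<in> ?ch" for v
      using that by (auto simp: child_verts_def is_child_def)
    have disj: "below v \<inter> below v' = {}" if "v \<in> ?ch" "v' \<in> ?ch" "v \<noteq> v'" for v v'
      using below_child_disjoint ch that by blast
    have IH: "tub_poly c w r (T - below u) =
        (\<Prod>v\<in>child_verts r (T - below u). ?\<phi> v ((T - below u) \<inter> below v))" if "u \<in> T - {r}" for u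
    proof (rule less.hyps)
      note cut = tubing_cut[OF root that]
      show "card (T - below u) < card T"
        using cut(4) fin by (intro psubset_card_mono) auto
      show "finite (T - below u)" "rooted r (T - below u)" using fin cut by auto
    qed
    \<comment> \<open>Cutting the edge to a child removes its factor from the product.\<close>
    have top: "tub_poly c w r (T - below v) = (\<Prod>v'\<in>?ch - {v}. ?\<phi> v' (T \<inter> below v'))"
      if v: "v \<in> ?ch" for v
    proof -
      have "v' \<notin> below v" if "v' \<in> ?ch - {v}" for v'
        using disj[OF v, of v'] that by (auto simp: below_def)
      then have "child_verts r (T - below v) = ?ch - {v}"
        by (auto simp: child_verts_def below_def)
      moreover have "(T - below v) \<inter> below v' = T \<inter> below v'" if "v' \<in> ?ch - {v}" for v'
        using disj[OF v, of v'] that by blast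
      ultimately show ?thesis using IH[OF ch(1)[OF v]] by simp
    qed
    \<comment> \<open>Cutting deeper inside one branch alters only the factor of that
      branch.\<close>
    have inner: "tub_poly c w r (T - below u) =
        ?\<phi> v (T \<inter> below v - below u) * (\<Prod>v'\<in>?ch - {v}. ?\<phi> v' (T \<inter> below v'))"
      if v: "v \<in> ?ch" and u: "u \<in> T \<inter> below v - {v}" for v u
    proof -
      have sub: "below u \<subseteq> below v" using u by (auto simp: below_def)
      have "v \<notin> below u" using u by (auto simp: below_def dest: prefix_order.antisym)
      moreover have "v' \<notin> below u" if "v' \<in> ?ch - {v}" for v'
        using disj[OF v, of v'] that sub by (auto simp: below_def)
      ultimately have "child_verts r (T - below u) = ?ch"
        by (auto simp: child_verts_def)
      moreover have "(T - below u) \<inter> below v' = T \<inter> below v'" if "v' \<in> ?ch - {v}" for v'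
        using disj[OF v, of v'] that sub by blast
      moreover have "(T - below u) \<inter> below v = T \<inter> below v - below u" by blast
      moreover have "u \<in> T - {r}" using u rooted_Diff_root[OF root] v by blast
      ultimately show ?thesis using IH[of u] v finch by (simp add: prod.remove[of ?ch v])
    qed
    \<comment> \<open>The cuts are grouped by the child below which they take place.\<close>
    have "pderiv (tub_poly c w r T) = (\<Sum>v\<in>?ch. \<Sum>u\<in>T \<inter> below v.
        smult (tub_const c w (T \<inter> below u)) (tub_poly c w r (T - below u)))"
      unfolding pderiv_tub_poly[OF fin root] rooted_Diff_root[OF root]
      using finch fin disj by (intro sum.UNION_disjoint) auto
    also have "\<dots> = (\<Sum>v\<in>?ch. (\<Prod>v'\<in>?ch - {v}. ?\<phi> v' (T \<inter> below v')) * pderiv (?\<phi> v (T \<inter> below v)))"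
    proof (rule sum.cong[OF refl])
      fix v assume v: "v \<in> ?ch"
      let ?X = "T \<inter> below v" and ?P = "\<Prod>v'\<in>?ch - {v}. ?\<phi> v' (T \<inter> below v')"
      note cut = tubing_cut[OF root ch(1)[OF v]]
      have X: "finite ?X" using fin by simp
      \<comment> \<open>The cut at \<open>v\<close> itself is split off; it yields the constant term
        of the derivative of the factor of \<open>v\<close>.\<close>
      have "(\<Sum>u\<in>?X. smult (tub_const c w (T \<inter> below u)) (tub_poly c w r (T - below u))) =
          smult (tub_const c w ?X) ?P +
          (\<Sum>u\<in>?X - {v}. smult (tub_const c w (T \<inter> below u)) (tub_poly c w r (T - below u)))"
        using X cut(6) top[OF v] by (simp add: sum.remove[of ?X v])
      also have "(\<Sum>u\<in>?X - {v}. smult (tub_const c w (T \<inter> below u)) (tub_poly c w r (T - below u))) =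
          (\<Sum>u\<in>?X - {v}. ?P * smult (tub_const c w (?X \<inter> below u)) (?\<phi> v (?X - below u)))"
      proof (rule sum.cong[OF refl])
        fix u assume u: "u \<in> ?X - {v}"
        then have "below u \<subseteq> below v" by (auto simp: below_def)
        then have "?X \<inter> below u = T \<inter> below u" by blast
        then show "smult (tub_const c w (T \<inter> below u)) (tub_poly c w r (T - below u)) =
            ?P * smult (tub_const c w (?X \<inter> below u)) (?\<phi> v (?X - below u))"
          using inner[OF v u] by (simp add: mult.commute)
      qed
      finally show "(\<Sum>u\<in>?X. smult (tub_const c w (T \<inter> below u)) (tub_poly c w r (T - below u))) =
          ?P * pderiv (?\<phi> v ?X)"
        by (simp add: pderiv_tub_mellin[OF X cut(2)] distrib_left sum_distrib_left)
    qed
    also have "\<dots> = pderiv (\<Prod>v\<in>?ch. ?\<phi> v (T \<inter> below v))"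
      by (simp add: pderiv_prod)
    finally have deriv: "pderiv (tub_poly c w r T) = pderiv (\<Prod>v\<in>?ch. ?\<phi> v (T \<inter> below v))" .
    have "T - {r} \<noteq> {}" using False rooted_mem[OF root] by blast
    \<comment> \<open>With at least one factor, and every factor vanishing at L = 0, the product has
      no constant term either.\<close>
    then have "?ch \<noteq> {}" using rooted_Diff_root[OF root] by auto
    moreover have "poly (?\<phi> v (T \<inter> below v)) 0 = 0" for v
      by (simp add: tub_mellin_def poly_0_coeff_0)
    ultimately have "poly (\<Prod>v\<in>?ch. ?\<phi> v (T \<inter> below v)) 0 = 0"
      using finch by (simp add: poly_prod card_gt_0_iff)
    then show ?thesis
      by (intro poly_eq_of_pderiv_eq[OF deriv]) (simp add: coeff_0_tub_poly[OF fin root False] poly_0_coeff_0)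
  qed
qed

subsection \<open>Weighted rooted trees\<close>

text \<open>The possible first steps of a path. The index keeps copies of equal child trees apart,
  so that sums and products over the multiset of children become sums and products over a finite
  set.\<close>

definition edges :: "wtree \<Rightarrow> (wtree \<times> nat) set" where
  "edges t = (SIGMA u:set_mset (subtrees t). {..<count (subtrees t) u})"

lemma mem_edges_iff: "e \<in> edges t \<longleftrightarrow> snd e < count (subtrees t) (fst e)"
  by (cases e) (auto simp: edges_def simp flip: count_greater_zero_iff)

lemma finite_edges [simp]: "finite (edges t)"
  by (simp add: edges_def)

lemma edges_fst: "e \<in> edges t \<Longrightarrow> fst e \<in># subtrees t"
  by (auto simp: edges_def)

lemma image_mset_fst_edges: "image_mset fst (mset_set (edges t)) = subtrees t"
proof (rule multiset_eqI)
  fix u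
  have "{e \<in> edges t. fst e = u} = Pair u ` {..<count (subtrees t) u}"
    by (auto simp: mem_edges_iff)
  then show "count (image_mset fst (mset_set (edges t))) u = count (subtrees t) u"
    by (simp add: count_image_mset' sum.reindex inj_on_def eq_commute[of u] mem_edges_iff)
qed

lemma prod_edges: "(\<Prod>e\<in>edges t. f (fst e)) = (\<Prod>u\<in>#subtrees t. f u)"
  by (subst image_mset_fst_edges[symmetric]) (simp add: prod_unfold_prod_mset multiset.map_comp comp_def)

lemma sum_edges: "(\<Sum>e\<in>edges t. f (fst e)) = (\<Sum>u\<in>#subtrees t. f u)"
  by (subst image_mset_fst_edges[symmetric]) (simp add: sum_unfold_sum_mset multiset.map_comp comp_def)

lemma card_edges: "card (edges t) = size (subtrees t)"
  by (subst image_mset_fst_edges[symmetric]) simp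

lemma Nil_in_verts [simp]: "[] \<in> verts t"
  by (simp add: verts_def)

lemma Cons_in_verts: "e # v \<in> verts t \<longleftrightarrow> e \<in> edges t \<and> v \<in> verts (fst e)"
  by (cases e) (simp add: verts_def mem_edges_iff)

lemma verts_eq: "verts t = insert [] (\<Union>e\<in>edges t. Cons e ` verts (fst e))"
proof (rule set_eqI)
  fix v show "v \<in> verts t \<longleftrightarrow> v \<in> insert [] (\<Union>e\<in>edges t. Cons e ` verts (fst e))"
    by (cases v) (auto simp: Cons_in_verts)
qed

lemma finite_verts [simp]: "finite (verts t)"
proof (induction t)
  case (Node k M)
  have "finite (verts (fst e))" if "e \<in> edges (Node k M)" for e
    using Node edges_fst[OF that] by simp
  then show ?case by (subst verts_eq) simp
qed

lemma verts_prefix: "v @ w \<in> verts t \<Longrightarrow> v \<in> verts t"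
  by (induction v arbitrary: t) (auto simp: Cons_in_verts)

lemma rooted_verts: "rooted [] (verts t)"
  by (auto simp: rooted_def prefix_def dest: verts_prefix)

lemma vweight_Nil [simp]: "vweight t [] = root_weight t"
  by (simp add: vweight_def)

lemma vweight_Cons [simp]: "vweight t (e # v) = vweight (fst e) v"
  by (cases e) (simp add: vweight_def)

lemma prod_verts:
  "(\<Prod>v\<in>verts t. f v) = f [] * (\<Prod>e\<in>edges t. \<Prod>v\<in>verts (fst e). f (e # v))"
proof -
  have "(\<Prod>v\<in>verts t. f v) = f [] * (\<Prod>v\<in>(\<Union>e\<in>edges t. Cons e ` verts (fst e)). f v)"
    by (subst verts_eq, subst prod.insert) auto
  also have "(\<Prod>v\<in>(\<Union>e\<in>edges t. Cons e ` verts (fst e)). f v) =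
      (\<Prod>e\<in>edges t. \<Prod>v\<in>Cons e ` verts (fst e). f v)"
    by (intro prod.UNION_disjoint) auto
  finally show ?thesis by (simp add: prod.reindex)
qed

lemma sum_verts:
  "(\<Sum>v\<in>verts t. f v) = f [] + (\<Sum>e\<in>edges t. \<Sum>v\<in>verts (fst e). f (e # v))"
proof -
  have "(\<Sum>v\<in>verts t. f v) = f [] + (\<Sum>v\<in>(\<Union>e\<in>edges t. Cons e ` verts (fst e)). f v)"
    by (subst verts_eq, subst sum.insert) auto
  also have "(\<Sum>v\<in>(\<Union>e\<in>edges t. Cons e ` verts (fst e)). f v) =
      (\<Sum>e\<in>edges t. \<Sum>v\<in>Cons e ` verts (fst e). f v)"
    by (intro sum.UNION_disjoint) auto
  finally show ?thesis by (simp add: sum.reindex)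
qed

lemma tweight_eq: "tweight t = root_weight t + (\<Sum>u\<in>#subtrees t. tweight u)"
  using sum_edges[of tweight t] by (simp add: tweight_def sum_verts[of _ t])

lemma weighted_trees_iff:
  "t \<in> weighted_trees \<longleftrightarrow> 1 \<le> root_weight t \<and> (\<forall>u\<in>#subtrees t. u \<in> weighted_trees)"
proof -
  have "(\<forall>e\<in>edges t. fst e \<in> weighted_trees) \<longleftrightarrow> (\<forall>u\<in>#subtrees t. u \<in> weighted_trees)"
    by (subst image_mset_fst_edges[symmetric]) simp
  moreover have "t \<in> weighted_trees \<longleftrightarrow> 1 \<le> root_weight t \<and> (\<forall>e\<in>edges t. fst e \<in> weighted_trees)"
    by (auto simp: weighted_trees_def verts_eq[of t])
  ultimately show ?thesis by simp
qed

lemma od_Nil: "od t [] = size (subtrees t)"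
proof -
  have "{v \<in> verts t. is_child [] v} = (\<lambda>e. [e]) ` edges t"
    by (auto simp: is_child_def Cons_in_verts)
  then show ?thesis by (simp add: od_def card_image inj_on_def card_edges)
qed

lemma od_Cons:
  assumes "e \<in> edges t"
  shows "od t (e # v) = od (fst e) v"
proof -
  have "{v' \<in> verts t. is_child (e # v) v'} = Cons e ` {v' \<in> verts (fst e). is_child v v'}"
    using assms by (auto simp: is_child_def Cons_in_verts)
  then show ?thesis by (simp add: od_def card_image)
qed

section \<open>Transport from a child tree into the whole tree\<close>

lemma rooted_Cons_image_iff: "rooted (e # r) (Cons e ` T) \<longleftrightarrow> rooted r T"
proof -
  have "(\<forall>p. prefix (e # r) p \<and> prefix p (e # v) \<longrightarrow> p \<in> Cons e ` T) \<longleftrightarrow>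
      (\<forall>p. prefix r p \<and> prefix p v \<longrightarrow> p \<in> T)" for v
  proof safe
    fix p assume "\<forall>p. prefix (e # r) p \<and> prefix p (e # v) \<longrightarrow> p \<in> Cons e ` T" "prefix r p" "prefix p v"
    then show "p \<in> T" by (auto dest: spec[of _ "e # p"])
  next
    fix p assume "\<forall>p. prefix r p \<and> prefix p v \<longrightarrow> p \<in> T" "prefix (e # r) p" "prefix p (e # v)"
    then show "p \<in> Cons e ` T" by (cases p) auto
  qed
  then show ?thesis by (simp add: rooted_def image_iff)
qed

lemma ex_rooted_Cons_image_iff: "(\<exists>r. rooted r (Cons e ` T)) \<longleftrightarrow> (\<exists>r. rooted r T)"
proof
  assume "\<exists>r. rooted r (Cons e ` T)"
  then obtain r where r: "rooted r (Cons e ` T)" by blast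
  then obtain r' where "r = e # r'" using rooted_mem[OF r] by blast
  then show "\<exists>r. rooted r T" using r rooted_Cons_image_iff by blast
qed (use rooted_Cons_image_iff in blast)

text \<open>Prepending an edge is injective and preserves inclusion, disjointness, unions,
  singletons and rootedness, which are all that the definition of a tubing mentions.\<close>

lemma Cons_image_tubings:
  "tubings (Cons e ` T) = (\<lambda>\<tau>. (`) (Cons e) ` \<tau>) ` tubings T"
proof -
  let ?h = "(`) (Cons e)"
  have inj: "inj (Cons e)" by simp
  have inj': "inj ?h" by (simp add: inj_image_eq_iff inj_def)
  have eq: "?h A = ?h B \<longleftrightarrow> A = B" and sub: "?h A \<subseteq> ?h B \<longleftrightarrow> A \<subseteq> B"
    and disj: "?h A \<inter> ?h B = {} \<longleftrightarrow> A \<inter> B = {}"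
    and un: "?h A \<union> ?h B = ?h C \<longleftrightarrow> A \<union> B = C" for A B C
    using inj by (simp_all add: inj_image_eq_iff inj_image_subset_iff
        flip: image_Int[OF inj] image_Un)
  have single: "(\<exists>v. ?h A = {v}) \<longleftrightarrow> (\<exists>v. A = {v})" for A
  proof
    assume "\<exists>v. ?h A = {v}"
    then obtain v where v: "?h A = {v}" by blast
    then obtain a where "a \<in> A" "v = e # a" by blast
    then have "?h A = ?h {a}" using v by simp
    then show "\<exists>v. A = {v}" unfolding eq by blast
  qed auto
  have iff: "?h ` \<tau> \<in> tubings (?h T) \<longleftrightarrow> \<tau> \<in> tubings T" for \<tau>
    unfolding tubings_def mem_Collect_eq ball_simps bex_simps eq sub disj un single
      ex_rooted_Cons_image_iff inj_image_mem_iff[OF inj'] ..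
  show ?thesis
  proof (intro equalityI subsetI)
    fix \<tau> assume \<tau>: "\<tau> \<in> tubings (?h T)"
    \<comment> \<open>Every tube is contained in the image of \<open>T\<close>, hence is itself an
      image; this pulls the tubing back.\<close>
    have "\<exists>B. A = ?h B" if "A \<in> \<tau>" for A
      using tubingsD(2)[OF \<tau> that] by (meson subset_imageE)
    then have "\<tau> \<subseteq> range ?h" by blast
    then obtain \<sigma> where "\<tau> = ?h ` \<sigma>" by (meson subset_imageE)
    then show "\<tau> \<in> (`) ?h ` tubings T" using \<tau> iff by blast
  qed (use iff in blast)
qed

lemma bstat_Cons_image: "bstat (e # v) ((`) (Cons e) ` \<tau>) = bstat v \<tau>"
proof -
  have "tube_root (Cons e ` A) (e # v) \<longleftrightarrow> tube_root A v" for A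
    by (auto simp: tube_root_def)
  then have "{T \<in> (`) (Cons e) ` \<tau>. tube_root T (e # v)} = (`) (Cons e) ` {T \<in> \<tau>. tube_root T v}"
    by auto
  moreover have "inj_on ((`) (Cons e)) X" for X
    by (simp add: inj_image_eq_iff inj_on_def)
  ultimately show ?thesis by (simp add: bstat_def card_image)
qed

lemma tub_mellin_Cons_image:
  "tub_mellin c w (e # r) (Cons e ` T) = tub_mellin c (\<lambda>v. w (e # v)) r T"
proof -
  have "nonroot_weight c w (e # r) (Cons e ` T) ((`) (Cons e) ` \<tau>) =
      nonroot_weight c (\<lambda>v. w (e # v)) r T \<tau>" for \<tau>
  proof -
    have "Cons e ` T - {e # r} = Cons e ` (T - {r})" by auto
    then show ?thesis by (simp add: nonroot_weight_def prod.reindex bstat_Cons_image)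
  qed
  moreover have "inj_on (\<lambda>\<tau>. (`) (Cons e) ` \<tau>) X" for X
  proof -
    have "inj ((`) (Cons e))" by (simp add: inj_image_eq_iff inj_def)
    then show ?thesis by (simp add: inj_on_def inj_image_eq_iff)
  qed
  ultimately show ?thesis
    by (simp add: tub_mellin_def tub_poly_def Cons_image_tubings sum.reindex bstat_Cons_image)
qed

section \<open>The recursion for sums over tubings of a tree\<close>

definition tree_poly :: "(nat \<Rightarrow> nat \<Rightarrow> real) \<Rightarrow> wtree \<Rightarrow> real poly" where
  "tree_poly c t = (\<Sum>\<tau>\<in>Tub t. phi c t \<tau>)"

lemma tree_poly_altdef: "tree_poly c t = tub_mellin c (vweight t) [] (verts t)"
  by (simp add: tree_poly_def tub_mellin_altdef[OF finite_verts rooted_verts] phi_def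
      mellin_monomial_def nonroot_weight_def tubings_verts)

text \<open>The product formula applied to all vertices: the branch at an edge \<open>e\<close> is a
  copy of the child tree \<open>fst e\<close>, so its factor is the polynomial of that tree. The
  remaining operator belongs to the root.\<close>

lemma tree_poly_eq:
  "tree_poly c t = mellin_op (\<lambda>i. c i (root_weight t)) (\<Prod>u\<in>#subtrees t. tree_poly c u)"
proof -
  have ch: "child_verts [] (verts t) = (\<lambda>e. [e]) ` edges t"
    by (auto simp: child_verts_def is_child_def Cons_in_verts)
  have "verts t \<inter> below [e] = Cons e ` verts (fst e)" if "e \<in> edges t" for e
    using that by (auto simp: below_def prefix_def Cons_in_verts)
  then have "tub_mellin c (vweight t) [e] (verts t \<inter> below [e]) = tree_poly c (fst e)"
    if "e \<in> edges t" for e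
    using that by (simp add: tub_mellin_Cons_image tree_poly_altdef)
  then have "tub_poly c (vweight t) [] (verts t) = (\<Prod>e\<in>edges t. tree_poly c (fst e))"
    unfolding tub_poly_eq_prod[OF finite_verts rooted_verts] ch
    by (subst prod.reindex) (simp_all add: inj_on_def)
  then show ?thesis
    by (simp add: tree_poly_altdef[of c t] tub_mellin_def prod_edges)
qed

lemma coeff_1_tree_poly:
  "coeff (tree_poly c t) 1 = (\<Sum>\<tau>\<in>Tub t. \<Prod>v\<in>verts t. c (bstat v \<tau> - 1) (vweight t v))"
  unfolding tree_poly_altdef coeff_1_tub_mellin[OF finite_verts rooted_verts]
  by (simp add: tub_const_def tubings_verts)

subsection \<open>Automorphisms\<close>

text \<open>Formulated with the parent relation instead of adjacency, and between two possibly
  different trees, so that it restricts to the branches of the root.\<close>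

definition tree_iso :: "wtree \<Rightarrow> wtree \<Rightarrow> (vertex \<Rightarrow> vertex) \<Rightarrow> bool" where
  "tree_iso t t' f \<longleftrightarrow> bij_betw f (verts t) (verts t') \<and> f [] = [] \<and>
     (\<forall>v e. v @ [e] \<in> verts t \<longrightarrow> (\<exists>e'. f (v @ [e]) = f v @ [e'])) \<and>
     (\<forall>v\<in>verts t. vweight t' (f v) = vweight t v)"

lemma tree_isoD:
  assumes "tree_iso t t' f"
  shows "bij_betw f (verts t) (verts t')" "inj_on f (verts t)" "f ` verts t = verts t'"
    "f [] = []" "v @ [e] \<in> verts t \<Longrightarrow> \<exists>e'. f (v @ [e]) = f v @ [e']"
    "v \<in> verts t \<Longrightarrow> vweight t' (f v) = vweight t v"
  using assms unfolding tree_iso_def bij_betw_def by blast+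

text \<open>Adjacency is symmetric, but since the root is fixed, an automorphism cannot reverse the
  direction of an edge.\<close>

lemma Aut_iff: "f \<in> Aut t \<longleftrightarrow> f permutes verts t \<and> tree_iso t t f"
proof
  assume f: "f \<in> Aut t"
  then have perm: "f permutes verts t" and Nil: "f [] = []"
    and adj: "\<And>u v. u \<in> verts t \<Longrightarrow> v \<in> verts t \<Longrightarrow> adjacent (f u) (f v) \<longleftrightarrow> adjacent u v"
    and weight: "\<And>v. v \<in> verts t \<Longrightarrow> vweight t (f v) = vweight t v"
    by (auto simp: Aut_def)
  have "\<exists>e'. f (v @ [e]) = f v @ [e']" if "v @ [e] \<in> verts t" for v e
    using that
  proof (induction v arbitrary: e rule: rev_induct)
    case Nil
    then show ?case using adj[of "[]" "[e]"] \<open>f [] = []\<close> by (auto simp: adjacent_def is_child_def)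
  next
    case (snoc d u)
    have v: "u @ [d] \<in> verts t" using snoc.prems verts_prefix by blast
    then obtain d' where d': "f (u @ [d]) = f u @ [d']" using snoc.IH by blast
    have "adjacent (f (u @ [d])) (f ((u @ [d]) @ [e]))"
      using adj[OF v snoc.prems] by (simp add: adjacent_def is_child_def)
    \<comment> \<open>The image is adjacent to that of its parent; injectivity excludes the image of
      the grandparent, so it lies one level further down.\<close>
    moreover have "f ((u @ [d]) @ [e]) \<noteq> f u"
      using permutes_inj[OF perm] by (auto simp: inj_eq)
    ultimately show ?case using d' by (auto simp: adjacent_def is_child_def)
  qed
  then show "f permutes verts t \<and> tree_iso t t f"
    using perm Nil weight permutes_imp_bij[OF perm] by (auto simp: tree_iso_def)
next
  assume "f permutes verts t \<and> tree_iso t t f"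
  then have perm: "f permutes verts t" and iso: "tree_iso t t f" by auto
  have child: "is_child (f u) (f v) \<longleftrightarrow> is_child u v" if uv: "u \<in> verts t" "v \<in> verts t" for u v
  proof
    assume "is_child u v"
    then show "is_child (f u) (f v)" using tree_isoD(5)[OF iso] that by (auto simp: is_child_def)
  next
    assume c: "is_child (f u) (f v)"
    then have "v \<noteq> []" using tree_isoD(4)[OF iso] by (auto simp: is_child_def)
    then obtain v' e where v': "v = v' @ [e]" by (metis rev_exhaust)
    then obtain e' where "f v = f v' @ [e']" using tree_isoD(5)[OF iso] uv by blast
    then have "f v' = f u" using c by (auto simp: is_child_def)
    then show "is_child u v" using v' permutes_inj[OF perm] by (auto simp: inj_eq is_child_def)
  qed
  show "f \<in> Aut t"
    using perm tree_isoD(4,6)[OF iso] child by (auto simp: Aut_def adjacent_def)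
qed

text \<open>An isomorphism is a bijection \<sigma> of the edges at the roots together with an
  isomorphism of each branch, read off as head and tail of the image path.\<close>

lemma tree_iso_edges:
  assumes iso: "tree_iso t t' f"
  obtains \<sigma> g where "bij_betw \<sigma> (edges t) (edges t')"
    "\<And>e. e \<in> edges t \<Longrightarrow> tree_iso (fst e) (fst (\<sigma> e)) (g e)"
    "\<And>e v. e \<in> edges t \<Longrightarrow> v \<in> verts (fst e) \<Longrightarrow> f (e # v) = \<sigma> e # g e v"
proof -
  define \<sigma> where "\<sigma> e = hd (f [e])" for e
  define g where "g e v = tl (f (e # v))" for e v
  \<comment> \<open>The image of a child extends the image of its parent, so all vertices of one
    branch share the first step of their images.\<close>
  have f: "f (e # v) = \<sigma> e # g e v" if "e \<in> edges t" "v \<in> verts (fst e)" for e v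
    using that(2)
  proof (induction v rule: rev_induct)
    case Nil
    have "[] @ [e] \<in> verts t" using that by (simp add: Cons_in_verts)
    then show ?case
      using tree_isoD(4)[OF iso] tree_isoD(5)[OF iso, of "[]" e] by (auto simp: \<sigma>_def g_def)
  next
    case (snoc x v)
    have "v \<in> verts (fst e)" using snoc.prems verts_prefix by blast
    moreover have "(e # v) @ [x] \<in> verts t" using snoc.prems that(1) by (simp add: Cons_in_verts)
    ultimately obtain x' where "f (e # v @ [x]) = \<sigma> e # g e v @ [x']"
      using snoc.IH tree_isoD(5)[OF iso, of "e # v" x] by auto
    then show ?case by (simp add: g_def)
  qed
  have g_Nil: "g e [] = []" if "e \<in> edges t" for e
    using tree_isoD(4)[OF iso] tree_isoD(5)[OF iso, of "[]" e] that
    by (auto simp: g_def Cons_in_verts)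
  have inj: "x = y" if "x \<in> verts t" "y \<in> verts t" "f x = f y" for x y
    using inj_onD[OF tree_isoD(2)[OF iso]] that by blast
  have range: "f x \<in> verts t'" if "x \<in> verts t" for x
    using tree_isoD(3)[OF iso] that by blast
  have preimage: "\<exists>e v. e \<in> edges t \<and> v \<in> verts (fst e) \<and> y = \<sigma> e # g e v"
    if y: "y \<in> verts t'" "y \<noteq> []" for y
  proof -
    have "y \<in> f ` verts t" using tree_isoD(3)[OF iso] y(1) by simp
    then obtain x where x: "x \<in> verts t" "y = f x" by blast
    then have "x \<noteq> []" using tree_isoD(4)[OF iso] y(2) by metis
    then obtain e v where ev: "x = e # v" by (cases x) auto
    then have "e \<in> edges t" "v \<in> verts (fst e)" using x by (auto simp: Cons_in_verts)
    then show ?thesis using f x(2) ev by blast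
  qed
  have \<sigma>_inj: "e = e'" if "e \<in> edges t" "e' \<in> edges t" "\<sigma> e = \<sigma> e'" for e e'
    using inj[of "[e]" "[e']"] that by (simp add: f g_Nil Cons_in_verts)
  have range': "\<sigma> e \<in> edges t' \<and> g e v \<in> verts (fst (\<sigma> e))" if "e \<in> edges t" "v \<in> verts (fst e)" for e v
    using range[of "e # v"] f[OF that] that by (auto simp: Cons_in_verts)
  have "bij_betw \<sigma> (edges t) (edges t')"
    unfolding bij_betw_def
  proof (intro conjI inj_onI equalityI subsetI)
    fix e' assume "e' \<in> edges t'"
    then obtain e v where "e \<in> edges t" "[e'] = \<sigma> e # g e v"
      using preimage[of "[e']"] by (auto simp: Cons_in_verts)
    then show "e' \<in> \<sigma> ` edges t" by auto
  next
    fix e' assume "e' \<in> \<sigma> ` edges t"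
    then show "e' \<in> edges t'" using range'[of _ "[]"] by auto
  qed (use \<sigma>_inj in blast)
  moreover have "tree_iso (fst e) (fst (\<sigma> e)) (g e)" if e: "e \<in> edges t" for e
    unfolding tree_iso_def
  proof (intro conjI allI impI ballI)
    show "bij_betw (g e) (verts (fst e)) (verts (fst (\<sigma> e)))"
      unfolding bij_betw_def
    proof (intro conjI inj_onI equalityI subsetI)
      fix x y assume "x \<in> verts (fst e)" "y \<in> verts (fst e)" "g e x = g e y"
      then show "x = y" using inj[of "e # x" "e # y"] f[OF e] e by (simp add: Cons_in_verts)
    next
      fix y assume y: "y \<in> verts (fst (\<sigma> e))"
      then have "\<sigma> e # y \<in> verts t'" using range'[OF e, of "[]"] by (simp add: Cons_in_verts)
      then obtain e1 v where "e1 \<in> edges t" "v \<in> verts (fst e1)" "\<sigma> e # y = \<sigma> e1 # g e1 v"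
        using preimage by blast
      then show "y \<in> g e ` verts (fst e)" using \<sigma>_inj[OF e, of e1] by auto
    qed (use range'[OF e] in blast)
    show "g e [] = []" by (rule g_Nil[OF e])
    show "\<exists>x'. g e (v @ [x]) = g e v @ [x']" if v: "v @ [x] \<in> verts (fst e)" for v x
    proof -
      have "v \<in> verts (fst e)" using v verts_prefix by blast
      then show ?thesis
        using tree_isoD(5)[OF iso, of "e # v" x] f[OF e, of v] f[OF e v] e v
        by (auto simp: Cons_in_verts)
    qed
    show "vweight (fst (\<sigma> e)) (g e v) = vweight (fst e) v" if v: "v \<in> verts (fst e)" for v
      using tree_isoD(6)[OF iso, of "e # v"] f[OF e v] e v by (simp add: Cons_in_verts)
  qed
  ultimately show ?thesis using that f by blast
qed

text \<open>Children form a multiset, so \<open>wtree\<close> already identifies isomorphic trees: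
  inductively, \<sigma> matches equal child trees, whence the multisets agree. Consequently an
  automorphism only permutes copies of equal children.\<close>

lemma tree_iso_imp_eq: "tree_iso t t' f \<Longrightarrow> t = t'"
proof (induction t arbitrary: t' f)
  case (Node k M)
  let ?t = "Node k M"
  obtain \<sigma> g where \<sigma>: "bij_betw \<sigma> (edges ?t) (edges t')"
    and g: "\<And>e. e \<in> edges ?t \<Longrightarrow> tree_iso (fst e) (fst (\<sigma> e)) (g e)"
    by (rule tree_iso_edges[OF Node.prems], rule that) blast+
  have fst: "fst (\<sigma> e) = fst e" if "e \<in> edges ?t" for e
    using Node.IH[OF _ g[OF that]] edges_fst[OF that] by simp
  have "subtrees t' = image_mset fst (image_mset \<sigma> (mset_set (edges ?t)))"
    using \<sigma> by (simp add: image_mset_mset_set bij_betw_def image_mset_fst_edges)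
  also have "\<dots> = image_mset fst (mset_set (edges ?t))"
    using fst by (auto simp: multiset.map_comp intro!: image_mset_cong)
  finally have "subtrees t' = M" by (simp add: image_mset_fst_edges)
  moreover have "root_weight t' = k"
    using tree_isoD(6)[OF Node.prems, of "[]"] tree_isoD(4)[OF Node.prems] by simp
  ultimately show ?case by (cases t') simp
qed

lemma permutes_finiteI:
  assumes "finite S" "\<And>x. x \<in> S \<Longrightarrow> p x \<in> S" "inj_on p S" "\<And>x. x \<notin> S \<Longrightarrow> p x = x"
  shows "p permutes S"
  using assms endo_inj_surj[of S p] by (intro bij_imp_permutes) (auto simp: bij_betw_def)

section \<open>Counting automorphisms\<close>

definition edge_perms :: "wtree \<Rightarrow> (wtree \<times> nat \<Rightarrow> wtree \<times> nat) set" where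
  "edge_perms t = {\<sigma>. \<sigma> permutes edges t \<and> (\<forall>e. fst (\<sigma> e) = fst e)}"

text \<open>Preserving the first component means permuting the copies of each child tree among
  themselves, independently for different child trees.\<close>

lemma card_edge_perms: "card (edge_perms t) = (\<Prod>u\<in>set_mset (subtrees t). fact (count (subtrees t) u))"
proof -
  let ?A = "set_mset (subtrees t)" and ?n = "count (subtrees t)"
  let ?P = "PiE ?A (\<lambda>u. {\<pi>. \<pi> permutes {..<?n u}})"
  let ?F = "\<lambda>\<pi> (u, i). if u \<in> ?A then (u, \<pi> u i) else (u, i)"
  have "bij_betw ?F ?P (edge_perms t)"
  proof (rule bij_betw_byWitness[where f' = "\<lambda>\<sigma>. \<lambda>u\<in>?A. \<lambda>i. snd (\<sigma> (u, i))"])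
    show "\<forall>\<pi>\<in>?P. (\<lambda>u\<in>?A. \<lambda>i. snd (?F \<pi> (u, i))) = \<pi>"
      by (auto simp: fun_eq_iff PiE_def extensional_def)
    show "\<forall>\<sigma>\<in>edge_perms t. ?F (\<lambda>u\<in>?A. \<lambda>i. snd (\<sigma> (u, i))) = \<sigma>"
    proof
      fix \<sigma> assume \<sigma>: "\<sigma> \<in> edge_perms t"
      have "\<sigma> (u, i) = (u, snd (\<sigma> (u, i)))" for u i
        using \<sigma> by (auto simp: edge_perms_def prod_eq_iff)
      moreover have "\<sigma> (u, i) = (u, i)" if "u \<notin> ?A" for u i
        using \<sigma> that edges_fst[of "(u, i)" t] permutes_not_in[of \<sigma> "edges t" "(u, i)"]
        by (auto simp: edge_perms_def)
      ultimately show "?F (\<lambda>u\<in>?A. \<lambda>i. snd (\<sigma> (u, i))) = \<sigma>"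
        by (auto simp: fun_eq_iff)
    qed
    show "?F ` ?P \<subseteq> edge_perms t"
    proof
      fix \<sigma> assume "\<sigma> \<in> ?F ` ?P"
      then obtain \<pi> where \<pi>: "\<pi> \<in> ?P" and \<sigma>: "\<sigma> = ?F \<pi>" by blast
      have p: "\<pi> u permutes {..<?n u}" if "u \<in> ?A" for u using \<pi> that by auto
      have "\<sigma> permutes edges t"
      proof (rule permutes_finiteI)
        fix e assume "e \<in> edges t"
        then show "\<sigma> e \<in> edges t"
          using permutes_in_image[OF p, of "fst e" "snd e"] unfolding \<sigma>
          by (cases e) (auto simp: edges_def)
      next
        show "inj_on \<sigma> (edges t)"
        proof (rule inj_onI)
          fix x y assume xy: "x \<in> edges t" "y \<in> edges t" "\<sigma> x = \<sigma> y"
          have A: "fst x \<in> ?A" "fst y \<in> ?A" using xy edges_fst by blast+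
          then have "fst x = fst y \<and> \<pi> (fst x) (snd x) = \<pi> (fst y) (snd y)"
            using xy(3) by (auto simp: \<sigma> case_prod_unfold)
          then show "x = y"
            using injD[OF permutes_inj[OF p[OF A(2)]]] by (metis prod_eq_iff)
        qed
      next
        fix e assume "e \<notin> edges t"
        then show "\<sigma> e = e"
          using permutes_not_in[OF p, of "fst e" "snd e"] unfolding \<sigma>
          by (cases e) (auto simp: edges_def)
      qed simp
      then show "\<sigma> \<in> edge_perms t" by (auto simp: edge_perms_def \<sigma>)
    qed
    show "(\<lambda>\<sigma>. \<lambda>u\<in>?A. \<lambda>i. snd (\<sigma> (u, i))) ` edge_perms t \<subseteq> ?P"
    proof (intro image_subsetI PiE_I)
      fix \<sigma> u assume \<sigma>: "\<sigma> \<in> edge_perms t" and u: "u \<in> ?A"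
      have perm: "\<sigma> permutes edges t" and pair: "\<sigma> (u, i) = (u, snd (\<sigma> (u, i)))" for i
        using \<sigma> by (auto simp: edge_perms_def prod_eq_iff)
      have "(\<lambda>i. snd (\<sigma> (u, i))) permutes {..<?n u}"
      proof (rule permutes_finiteI)
        fix i assume "i \<in> {..<?n u}"
        then show "snd (\<sigma> (u, i)) \<in> {..<?n u}"
          using permutes_in_image[OF perm, of "(u, i)"] pair[of i] by (metis fst_conv lessThan_iff mem_edges_iff snd_conv)
      next
        show "inj_on (\<lambda>i. snd (\<sigma> (u, i))) {..<?n u}"
        proof (rule inj_onI)
          fix i j assume "snd (\<sigma> (u, i)) = snd (\<sigma> (u, j))"
          then have "\<sigma> (u, i) = \<sigma> (u, j)" using pair[of i] pair[of j] by simp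
          then show "i = j" using injD[OF permutes_inj[OF perm]] by blast
        qed
      next
        fix i assume "i \<notin> {..<?n u}"
        then show "snd (\<sigma> (u, i)) = i"
          using permutes_not_in[OF perm, of "(u, i)"] by (auto simp: mem_edges_iff)
      qed simp
      then show "(\<lambda>u\<in>?A. \<lambda>i. snd (\<sigma> (u, i))) u \<in> {\<pi>. \<pi> permutes {..<?n u}}" using u by simp
    qed simp
  qed
  then have "card ?P = card (edge_perms t)" by (rule bij_betw_same_card)
  moreover have "card ?P = (\<Prod>u\<in>?A. fact (?n u))"
    by (subst card_PiE) (simp_all add: card_permutations)
  ultimately show ?thesis by (rule subst)
qed

text \<open>Reassembles an automorphism from its action on the root edges and on the branches. The
  identity outside the tree is what \<open>permutes\<close> demands.\<close>

definition glue :: "wtree \<Rightarrow> (wtree \<times> nat \<Rightarrow> wtree \<times> nat) \<times> (wtree \<times> nat \<Rightarrow> vertex \<Rightarrow> vertex) \<Rightarrow>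
    vertex \<Rightarrow> vertex" where
  "glue t = (\<lambda>(\<sigma>, g) v. if v \<in> verts t then (case v of [] \<Rightarrow> [] | e # p \<Rightarrow> \<sigma> e # g e p) else v)"

lemma glue_in_Aut:
  assumes \<sigma>: "\<sigma> \<in> edge_perms t" and g: "\<And>e. e \<in> edges t \<Longrightarrow> g e \<in> Aut (fst e)"
  shows "glue t (\<sigma>, g) \<in> Aut t"
proof -
  let ?f = "glue t (\<sigma>, g)"
  have perm: "\<sigma> permutes edges t" and fst: "fst (\<sigma> e) = fst e" for e
    using \<sigma> unfolding edge_perms_def by blast+
  have gp: "g e permutes verts (fst e)" and gi: "tree_iso (fst e) (fst e) (g e)" if "e \<in> edges t" for e
    using g[OF that] by (auto simp: Aut_iff)
  have Nil: "?f [] = []" by (simp add: glue_def)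
  have Cons: "?f (e # v) = \<sigma> e # g e v" if "e # v \<in> verts t" for e v
    using that by (simp add: glue_def)
  have f_perm: "?f permutes verts t"
  proof (rule permutes_finiteI)
    fix v assume v: "v \<in> verts t"
    show "?f v \<in> verts t"
    proof (cases v)
      case (Cons e p)
      then have "e \<in> edges t" "p \<in> verts (fst e)" using v by (auto simp: Cons_in_verts)
      then have "\<sigma> e \<in> edges t" "g e p \<in> verts (fst e)"
        using permutes_in_image[OF perm] permutes_in_image[OF gp] by blast+
      then show ?thesis using v Cons \<open>\<And>e v. e # v \<in> verts t \<Longrightarrow> ?f (e # v) = \<sigma> e # g e v\<close>
        by (simp add: Cons_in_verts fst)
    qed (simp add: Nil)
  next
    show "inj_on ?f (verts t)"
    proof (rule inj_onI)
      fix x y assume xy: "x \<in> verts t" "y \<in> verts t" "?f x = ?f y"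
      show "x = y"
      proof (cases x)
        case Nil': Nil
        then show ?thesis using xy Nil Cons by (cases y) auto
      next
        case x: (Cons e p)
        then obtain e' p' where y: "y = e' # p'" using xy Nil Cons by (cases y) auto
        have "\<sigma> e = \<sigma> e'" "g e p = g e' p'" using xy x y Cons by auto
        then have "e = e'" using permutes_inj[OF perm] by (simp add: inj_eq)
        moreover have "e \<in> edges t" using xy x by (simp add: Cons_in_verts)
        ultimately show ?thesis
          using x y \<open>g e p = g e' p'\<close> permutes_inj[OF gp] by (auto simp: inj_eq)
      qed
    qed
  next
    fix v assume "v \<notin> verts t"
    then show "?f v = v" by (simp add: glue_def)
  qed simp
  moreover have "tree_iso t t ?f"
    unfolding tree_iso_def
  proof (intro conjI allI impI ballI)
    show "bij_betw ?f (verts t) (verts t)" by (rule permutes_imp_bij[OF f_perm])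
    show "?f [] = []" by (rule Nil)
    show "\<exists>x'. ?f (v @ [x]) = ?f v @ [x']" if vx: "v @ [x] \<in> verts t" for v x
    proof (cases v)
      case Nil': Nil
      then have "x \<in> edges t" using vx by (simp add: Cons_in_verts)
      then show ?thesis using Nil' vx Cons[of x "[]"] Nil tree_isoD(4)[OF gi] by simp
    next
      case v: (Cons e p)
      then have e: "e \<in> edges t" "p @ [x] \<in> verts (fst e)" "e # p \<in> verts t"
        using vx verts_prefix by (auto simp: Cons_in_verts)
      then show ?thesis
        using tree_isoD(5)[OF gi[OF e(1)] e(2)] v vx Cons[of e p] Cons[of e "p @ [x]"] by auto
    qed
    show "vweight t (?f v) = vweight t v" if v: "v \<in> verts t" for v
    proof (cases v)
      case (Cons e p)
      then have "e \<in> edges t" "p \<in> verts (fst e)" using v by (auto simp: Cons_in_verts)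
      then show ?thesis
        using v Cons tree_isoD(6)[OF gi] \<open>\<And>e v. e # v \<in> verts t \<Longrightarrow> ?f (e # v) = \<sigma> e # g e v\<close>
        by (simp add: fst)
    qed (simp add: Nil)
  qed
  ultimately show ?thesis by (simp add: Aut_iff)
qed

lemma tree_iso_cong:
  assumes "tree_iso t t' f" "\<And>v. v \<in> verts t \<Longrightarrow> f v = f' v"
  shows "tree_iso t t' f'"
proof -
  have "bij_betw f' (verts t) (verts t')"
    using tree_isoD(1)[OF assms(1)] bij_betw_cong[of "verts t" f f'] assms(2) by blast
  moreover have "\<exists>e'. f' (v @ [e]) = f' v @ [e']" if "v @ [e] \<in> verts t" for v e
    using tree_isoD(5)[OF assms(1) that] assms(2)[OF that] assms(2)[OF verts_prefix[OF that]] by simp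
  moreover have "f' [] = []" using tree_isoD(4)[OF assms(1)] assms(2)[of "[]"] by simp
  moreover have "vweight t' (f' v) = vweight t v" if "v \<in> verts t" for v
    using tree_isoD(6)[OF assms(1) that] assms(2)[OF that] by simp
  ultimately show ?thesis unfolding tree_iso_def by blast
qed

text \<open>The automorphism group decomposes, as a set, into the permutations of equal branches
  times the automorphisms of the individual branches.\<close>

lemma bij_betw_glue:
  "bij_betw (glue t) (edge_perms t \<times> PiE (edges t) (\<lambda>e. Aut (fst e))) (Aut t)"
  unfolding bij_betw_def
proof (intro conjI)
  show "inj_on (glue t) (edge_perms t \<times> PiE (edges t) (\<lambda>e. Aut (fst e)))"
  proof (rule inj_onI)
    fix x y assume x: "x \<in> edge_perms t \<times> PiE (edges t) (\<lambda>e. Aut (fst e))"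
      and y: "y \<in> edge_perms t \<times> PiE (edges t) (\<lambda>e. Aut (fst e))" and eq: "glue t x = glue t y"
    obtain \<sigma> g \<sigma>' g' where xy: "x = (\<sigma>, g)" "y = (\<sigma>', g')" by (cases x, cases y) auto
    have \<sigma>: "\<sigma> permutes edges t" "\<sigma>' permutes edges t"
      and g: "g \<in> PiE (edges t) (\<lambda>e. Aut (fst e))" "g' \<in> PiE (edges t) (\<lambda>e. Aut (fst e))"
      using x y by (auto simp: xy edge_perms_def)
    have *: "\<sigma> e = \<sigma>' e \<and> g e v = g' e v" if "e \<in> edges t" "v \<in> verts (fst e)" for e v
      using fun_cong[OF eq, of "e # v"] that by (simp add: xy glue_def Cons_in_verts)
    have "\<sigma> e = \<sigma>' e" for e
      using *[of e "[]"] \<sigma> by (cases "e \<in> edges t") (auto simp: permutes_not_in)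
    moreover have "g e = g' e" if e: "e \<in> edges t" for e
    proof
      fix v
      have "g e permutes verts (fst e)" "g' e permutes verts (fst e)"
        using PiE_mem[OF g(1) e] PiE_mem[OF g(2) e] by (auto simp: Aut_iff)
      then show "g e v = g' e v"
        using *[OF e, of v] by (cases "v \<in> verts (fst e)") (auto simp: permutes_not_in)
    qed
    ultimately show "x = y" using PiE_ext[OF g] by (auto simp: xy)
  qed
  show "glue t ` (edge_perms t \<times> PiE (edges t) (\<lambda>e. Aut (fst e))) = Aut t"
  proof (intro equalityI subsetI)
    fix f assume f: "f \<in> Aut t"
    then have perm: "f permutes verts t" and iso: "tree_iso t t f" by (auto simp: Aut_iff)
    obtain \<sigma> g where \<sigma>: "bij_betw \<sigma> (edges t) (edges t)"
      and g: "\<And>e. e \<in> edges t \<Longrightarrow> tree_iso (fst e) (fst (\<sigma> e)) (g e)"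
      and fg: "\<And>e v. e \<in> edges t \<Longrightarrow> v \<in> verts (fst e) \<Longrightarrow> f (e # v) = \<sigma> e # g e v"
      by (rule tree_iso_edges[OF iso], rule that) blast+
    have fst: "fst (\<sigma> e) = fst e" if "e \<in> edges t" for e
      using tree_iso_imp_eq[OF g[OF that]] by simp
    \<comment> \<open>The decomposition of \<open>f\<close> determines \<sigma> and \<open>g\<close>
      only on actual edges and vertices; elsewhere they are normalised as \<open>permutes\<close>
      and \<open>PiE\<close> require.\<close>
    define \<sigma>' where "\<sigma>' e = (if e \<in> edges t then \<sigma> e else e)" for e
    define g' where "g' = (\<lambda>e\<in>edges t. \<lambda>v. if v \<in> verts (fst e) then g e v else v)"
    have "bij_betw \<sigma>' (edges t) (edges t)"
      using \<sigma> bij_betw_cong[of "edges t" \<sigma> \<sigma>'] by (simp add: \<sigma>'_def)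
    then have "\<sigma>' permutes edges t"
      by (rule bij_imp_permutes) (simp add: \<sigma>'_def)
    then have "\<sigma>' \<in> edge_perms t" using fst by (auto simp: edge_perms_def \<sigma>'_def)
    moreover have "g' \<in> PiE (edges t) (\<lambda>e. Aut (fst e))"
    proof (rule PiE_I)
      fix e assume e: "e \<in> edges t"
      have iso': "tree_iso (fst e) (fst e) (g' e)"
        by (rule tree_iso_cong[OF g[OF e, unfolded fst[OF e]]]) (simp add: g'_def e)
      moreover have "g' e permutes verts (fst e)"
        by (rule bij_imp_permutes[OF tree_isoD(1)[OF iso']]) (simp add: g'_def e)
      ultimately show "g' e \<in> Aut (fst e)" by (simp add: Aut_iff)
    qed (simp add: g'_def)
    moreover have "glue t (\<sigma>', g') v = f v" for v
      using permutes_not_in[OF perm] tree_isoD(4)[OF iso] fg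
      by (cases v) (auto simp: glue_def \<sigma>'_def g'_def Cons_in_verts)
    then have "glue t (\<sigma>', g') = f" ..
    ultimately show "f \<in> glue t ` (edge_perms t \<times> PiE (edges t) (\<lambda>e. Aut (fst e)))"
      by (intro image_eqI[of _ _ "(\<sigma>', g')"]) auto
  next
    fix f assume "f \<in> glue t ` (edge_perms t \<times> PiE (edges t) (\<lambda>e. Aut (fst e)))"
    then show "f \<in> Aut t" by (auto intro!: glue_in_Aut dest: PiE_mem)
  qed
qed

lemma card_Aut:
  "card (Aut t) = (\<Prod>u\<in>set_mset (subtrees t). fact (count (subtrees t) u)) *
     (\<Prod>u\<in>#subtrees t. card (Aut u))"
  using bij_betw_same_card[OF bij_betw_glue[of t]]
  by (simp add: card_cartesian_product card_PiE card_edge_perms prod_edges[of "\<lambda>u. card (Aut u)"])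

lemma tree_coeff_eq:
  "tree_coeff s t = falling_factorial (1 + s * real (root_weight t)) (size (subtrees t)) /
     (\<Prod>u\<in>set_mset (subtrees t). fact (count (subtrees t) u)) * (\<Prod>u\<in>#subtrees t. tree_coeff s u)"
proof -
  define h where "h t = (\<Prod>v\<in>verts t. falling_factorial (1 + s * real (vweight t v)) (od t v))" for t
  have "h t = falling_factorial (1 + s * real (root_weight t)) (size (subtrees t)) *
      (\<Prod>e\<in>edges t. h (fst e))"
    unfolding h_def prod_verts[of _ t] by (simp add: od_Nil od_Cons)
  moreover have "(\<Prod>u\<in>#subtrees t. tree_coeff s u) =
      (\<Prod>u\<in>#subtrees t. h u) / real (\<Prod>u\<in>#subtrees t. card (Aut u))"
    by (simp add: tree_coeff_def h_def flip: prod_edges) (simp add: prod_dividef)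
  ultimately show ?thesis
    by (simp add: tree_coeff_def h_def[symmetric] card_Aut[of t] prod_edges[of h])
qed

subsection \<open>Power series\<close>

text \<open>If a finite index set contains every \<open>a\<close> with \<open>d a \<le> n\<close>,
  the partial sum agrees with \<open>S\<close> up to order n. Its distance from \<open>S\<close> is
  then smaller than 2^(-n).\<close>

lemma has_sum_fpsI:
  fixes f :: "'b \<Rightarrow> 'a :: ab_group_add fps"
  assumes fin: "\<And>n. finite {a \<in> A. d a \<le> (n :: nat)}"
    and zero: "\<And>a m. a \<in> A \<Longrightarrow> m < d a \<Longrightarrow> fps_nth (f a) m = 0"
    and S: "\<And>n. fps_nth S n = (\<Sum>a\<in>{a \<in> A. d a \<le> n}. fps_nth (f a) n)"
  shows "(f has_sum S) A"
  unfolding has_sum_def tendsto_iff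
proof (intro allI impI)
  fix \<epsilon> :: real assume "\<epsilon> > 0"
  then obtain n where n: "inverse (2 ^ n) < \<epsilon>"
    using real_arch_pow_inv[of \<epsilon> "1 / 2"] by (auto simp: power_one_over inverse_eq_divide)
  have "dist (sum f X) S < \<epsilon>" if X: "finite X" "{a \<in> A. d a \<le> n} \<subseteq> X" "X \<subseteq> A" for X
  proof (cases "sum f X = S")
    case False
    have "fps_nth (sum f X - S) m = 0" if m: "m \<le> n" for m
    proof -
      have "(\<Sum>a\<in>X. fps_nth (f a) m) = (\<Sum>a\<in>{a \<in> A. d a \<le> m}. fps_nth (f a) m)"
      proof (rule sum.mono_neutral_right[OF X(1)])
        show "{a \<in> A. d a \<le> m} \<subseteq> X" using X(2) m by auto
        show "\<forall>a\<in>X - {a \<in> A. d a \<le> m}. fps_nth (f a) m = 0" 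
          using X(3) zero not_le by blast
      qed
      then show ?thesis by (simp add: S fps_sum_nth)
    qed
    moreover have "fps_nth (sum f X - S) (subdegree (sum f X - S)) \<noteq> 0"
      using False by (intro nth_subdegree_nonzero) simp
    ultimately have "n < subdegree (sum f X - S)" by (meson not_less)
    then have "inverse (2 ^ subdegree (sum f X - S)) \<le> (inverse (2 ^ n) :: real)"
      by (intro le_imp_inverse_le power_increasing) auto
    then show ?thesis using n unfolding dist_fps_def if_not_P[OF False] by linarith
  qed (use \<open>\<epsilon> > 0\<close> in simp)
  then show "\<forall>\<^sub>F X in finite_subsets_at_top A. dist (sum f X) S < \<epsilon>"
    unfolding eventually_finite_subsets_at_top using fin[of n] by (intro exI[of _ "{a \<in> A. d a \<le> n}"]) auto
qed

lemma fps_power_nth_cong: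
  fixes f g :: "'a :: comm_semiring_1 fps"
  assumes "\<And>j. j \<le> m \<Longrightarrow> fps_nth f j = fps_nth g j"
  shows "fps_nth (f ^ i) m = fps_nth (g ^ i) m"
  using assms
proof (induction i arbitrary: m)
  case (Suc i)
  have "fps_nth (f ^ i) j = fps_nth (g ^ i) j" if "j \<le> m" for j
    using Suc.prems that by (intro Suc.IH) simp
  then show ?case
    using Suc.prems by (simp add: fps_mult_nth)
qed simp

section \<open>Binomial powers and the differential operator\<close>

lemma fps_nth_binomial_power:
  "fps_nth (binomial_power G a) m = (\<Sum>i=0..m. smult (a gchoose i) (fps_nth ((G - 1) ^ i) m))"
  by (simp add: binomial_power_def fps_compose_nth)

lemma binomial_power_nth_cong:
  assumes "\<And>j. j \<le> m \<Longrightarrow> fps_nth G j = fps_nth G' j"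
  shows "fps_nth (binomial_power G a) m = fps_nth (binomial_power G' a) m"
proof -
  have "fps_nth ((G - 1) ^ i) m = fps_nth ((G' - 1) ^ i) m" for i
    using assms by (intro fps_power_nth_cong) simp
  then show ?thesis by (simp add: fps_nth_binomial_power)
qed

lemma higher_fls_deriv_nth_0: "fls_nth ((fls_deriv ^^ j) H) 0 = of_nat (fact j) * fls_nth H (int j)"
  for H :: "real poly fls"
proof -
  \<comment> \<open>The induction needs arbitrary nonnegative positions, since each derivative moves
    the position up by one.\<close>
  have "fls_nth ((fls_deriv ^^ j) H) (int n) = of_nat (\<Prod>i=1..j. n + i) * fls_nth H (int (n + j))" for n
  proof (induction j arbitrary: n)
    case (Suc j)
    have "fls_nth ((fls_deriv ^^ Suc j) H) (int n) =
        of_nat (Suc n) * fls_nth ((fls_deriv ^^ j) H) (int (Suc n))"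
      by (simp add: add.commute)
    also have "\<dots> = of_nat (Suc n * (\<Prod>i=1..j. Suc n + i)) * fls_nth H (int (n + Suc j))"
      by (simp only: Suc.IH of_nat_mult mult.assoc add_Suc add_Suc_right)
    also have "Suc n * (\<Prod>i=1..j. Suc n + i) = (\<Prod>i=1..Suc j. n + i)"
      by (simp add: prod.atLeast_Suc_atMost prod.shift_bounds_cl_Suc_ivl del: prod.cl_ivl_Suc)
    finally show ?case .
  qed simp
  from this[of 0] show ?thesis by (simp add: fact_prod)
qed

text \<open>Links the analytic form of the equation to \<Lambda>: the j-th derivative at 0 is j!
  times the coefficient of \<rho>^j, and those coefficients are the inner sums of
  \<open>mellin_op\<close>.\<close>

lemma diff_op_at_0_eq_mellin_op:
  assumes "fls_subdegree F \<ge> -1" "\<And>i. a i = fls_nth F (int i - 1)"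
  shows "fps_nth (diff_op_at_0 P ((exp_L_rho - 1) * fls_pconst F)) m = mellin_op a (fps_nth P m)"
proof -
  define E where "E = Abs_fps (\<lambda>n. monom (1 / fact n) n :: real poly) - 1"
  define f where "f = Abs_fps (\<lambda>i. [:a i:])"
  \<comment> \<open>The pole is at most simple, so one factor 1/\<rho> splits off and leaves a power
    series.\<close>
  have F: "fls_pconst F = fls_X_inv * fps_to_fls f"
  proof (rule fls_eqI)
    fix n :: int
    show "fls_nth (fls_pconst F) n = fls_nth (fls_X_inv * fps_to_fls f) n"
    proof (cases "n \<ge> -1")
      case True
      then have "int (nat (n + 1)) - 1 = n" by simp
      then show ?thesis
        using True by (simp add: fls_pconst.rep_eq fls_X_inv_times_conv_shift f_def assms(2))
    next
      case False
      then have "fls_nth F n = 0" using assms(1) by (intro fls_eq0_below_subdegree) simp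
      then show ?thesis
        using False by (simp add: fls_pconst.rep_eq fls_X_inv_times_conv_shift)
    qed
  qed
  have "exp_L_rho - 1 = fps_to_fls E"
    by (simp add: exp_L_rho_def E_def fps_to_fls_minus)
  then have "(exp_L_rho - 1) * fls_pconst F = fls_X_inv * fps_to_fls (E * f)"
    by (simp add: F fls_times_fps_to_fls mult_ac)
  \<comment> \<open>The factor 1/\<rho> shifts position \<open>j\<close> to \<open>Suc j\<close>,
    which explains the upper limit in \<open>mellin_op\<close>.\<close>
  then have H: "fls_nth ((exp_L_rho - 1) * fls_pconst F) (int j) = fps_nth (E * f) (Suc j)" for j
    by (simp add: fls_X_inv_times_conv_shift nat_add_distrib)
  have "fps_nth (E * f) (Suc j) = (\<Sum>i=1..Suc j. monom (a (Suc j - i) / fact i) i)" for j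
  proof -
    have "fps_nth (E * f) (Suc j) = (\<Sum>i=0..Suc j. fps_nth E i * fps_nth f (Suc j - i))"
      by (rule fps_mult_nth)
    \<comment> \<open>The summand i = 0 vanishes because the exponential minus 1 has no constant
      term.\<close>
    also have "\<dots> = (\<Sum>i=1..Suc j. fps_nth E i * fps_nth f (Suc j - i))"
      by (intro sum.mono_neutral_right) (auto simp: E_def not_le)
    also have "\<dots> = (\<Sum>i=1..Suc j. monom (a (Suc j - i) / fact i) i)"
      by (intro sum.cong refl) (auto simp: E_def f_def smult_monom)
    finally show ?thesis .
  qed
  then have "fps_nth (diff_op_at_0 P ((exp_L_rho - 1) * fls_pconst F)) m =
      (\<Sum>j\<le>degree (fps_nth P m). [:coeff (fps_nth P m) j:] *
        (of_nat (fact j) * (\<Sum>i=1..Suc j. monom (a (Suc j - i) / fact i) i)))"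
    unfolding diff_op_at_0_def diff_op_def fps_nth_Abs_fps fls_nth_sum fls_mult_const_nth
      higher_fls_deriv_nth_0 H by (simp only:)
  also have "\<dots> = mellin_op a (fps_nth P m)"
    unfolding mellin_op_def by (intro sum.cong refl) (simp add: of_nat_poly mult.commute)
  finally show ?thesis .
qed

section \<open>Finiteness by weight and expansion of powers\<close>

lemma tweight_pos: "t \<in> weighted_trees \<Longrightarrow> 1 \<le> tweight t"
  unfolding tweight_eq[of t] weighted_trees_iff[of t] by simp

lemma size_le_sum_tweight:
  assumes "set_mset M \<subseteq> weighted_trees"
  shows "size M \<le> (\<Sum>u\<in>#M. tweight u)"
  using assms
proof (induction M)
  case (add u M)
  then show ?case using tweight_pos[of u] by simp
qed simp

text \<open>The root has weight at least 1, so a tree of weight at most n + 1 has at most n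
  children, each of weight at most n. Listing the children reduces this to bounded lists over a
  finite set.\<close>

lemma finite_weighted_trees_le: "finite {t \<in> weighted_trees. tweight t \<le> n}"
proof (induction n)
  case 0
  have "{t \<in> weighted_trees. tweight t \<le> 0} = {}" using tweight_pos by force
  then show ?case by (simp only: finite.emptyI)
next
  case (Suc n)
  let ?A = "{t \<in> weighted_trees. tweight t \<le> n}"
  let ?L = "{xs. set xs \<subseteq> ?A \<and> length xs \<le> n}"
  have "{t \<in> weighted_trees. tweight t \<le> Suc n} \<subseteq> (\<lambda>(k, xs). Node k (mset xs)) ` ({..Suc n} \<times> ?L)"
  proof
    fix t assume t: "t \<in> {t \<in> weighted_trees. tweight t \<le> Suc n}"
    obtain k M where kM: "t = Node k M" by (cases t)
    have M: "set_mset M \<subseteq> weighted_trees" "1 \<le> k" "k + (\<Sum>u\<in>#M. tweight u) \<le> Suc n"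
      using t tweight_eq[of t] weighted_trees_iff[of t] by (auto simp: kM)
    obtain xs where xs: "mset xs = M" using ex_mset by blast
    have "tweight u \<le> n" if u: "u \<in># M" for u
    proof -
      obtain M' where "M = add_mset u M'" using multi_member_split[OF u] by blast
      then show ?thesis using M(2,3) by simp
    qed
    then have "set xs \<subseteq> ?A" using M(1) xs by auto
    moreover have "length xs \<le> n" using size_le_sum_tweight[OF M(1)] M(2,3) xs by auto
    moreover have "k \<le> Suc n" using M(3) by simp
    ultimately show "t \<in> (\<lambda>(k, xs). Node k (mset xs)) ` ({..Suc n} \<times> ?L)"
      by (intro image_eqI[of _ _ "(k, xs)"]) (simp_all add: kM xs)
  qed
  moreover have "finite ({..Suc n} \<times> ?L)"
    using finite_lists_length_le[OF Suc.IH] by simp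
  ultimately show ?case by (meson finite_imageI finite_subset)
qed

lemma fps_power_nth_lists:
  fixes q :: "'a \<Rightarrow> 'b :: comm_semiring_1" and d :: "'a \<Rightarrow> nat"
  assumes fin: "\<And>n. finite {a \<in> A. d a = n}"
  defines "L \<equiv> \<lambda>i m. {xs \<in> lists A. length xs = i \<and> sum_list (map d xs) = m}"
  shows "finite (L i m)"
    and "fps_nth (Abs_fps (\<lambda>n. \<Sum>a\<in>{a \<in> A. d a = n}. q a) ^ i) m = (\<Sum>xs\<in>L i m. prod_list (map q xs))"
proof -
  let ?S = "\<lambda>i m. SIGMA j:{0..m}. {a \<in> A. d a = j} \<times> L i (m - j)"
  \<comment> \<open>The index \<open>j\<close> is the weight of the first entry, in accordance with
    the Cauchy product.\<close>
  have bij: "bij_betw (\<lambda>(j, a, xs). a # xs) (?S i m) (L (Suc i) m)" for i m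
    by (rule bij_betw_byWitness[where f' = "\<lambda>xs. (d (hd xs), hd xs, tl xs)"])
      (auto simp: L_def length_Suc_conv)
  have fin_L: "finite (L i m)" for i m
  proof (induction i arbitrary: m)
    case 0
    have "L 0 m \<subseteq> {[]}" by (auto simp: L_def)
    then show ?case using finite_subset by blast
  next
    case (Suc i)
    have "finite (?S i m)" using Suc.IH fin by (intro finite_SigmaI finite_cartesian_product) auto
    then show ?case using bij_betw_finite[OF bij] by blast
  qed
  then show "finite (L i m)" .
  show "fps_nth (Abs_fps (\<lambda>n. \<Sum>a\<in>{a \<in> A. d a = n}. q a) ^ i) m = (\<Sum>xs\<in>L i m. prod_list (map q xs))"
  proof (induction i arbitrary: m)
    case 0
    have "L 0 m = (if m = 0 then {[]} else {})" by (auto simp: L_def)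
    then show ?case by simp
  next
    case (Suc i)
    have "fps_nth (Abs_fps (\<lambda>n. \<Sum>a\<in>{a \<in> A. d a = n}. q a) ^ Suc i) m =
        (\<Sum>j=0..m. \<Sum>a\<in>{a \<in> A. d a = j}. \<Sum>xs\<in>L i (m - j). q a * prod_list (map q xs))"
      by (simp add: fps_mult_nth Suc.IH sum_product)
    also have "\<dots> = (\<Sum>j=0..m. \<Sum>(a, xs)\<in>{a \<in> A. d a = j} \<times> L i (m - j). q a * prod_list (map q xs))"
      by (simp add: sum.cartesian_product)
    also have "\<dots> = (\<Sum>(j, a, xs)\<in>?S i m. q a * prod_list (map q xs))"
      using fin fin_L by (subst sum.Sigma) auto
    also have "\<dots> = (\<Sum>xs\<in>L (Suc i) m. prod_list (map q xs))"
      by (subst sum.reindex_bij_betw[OF bij, symmetric]) (simp add: case_prod_unfold)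
    finally show ?case .
  qed
qed

text \<open>Lists are grouped by their multiset of entries: the product does not depend on the
  order, and the number of lists is the number of orderings.\<close>

lemma fps_power_nth_multisets:
  fixes q :: "'a \<Rightarrow> 'b :: comm_semiring_1" and d :: "'a \<Rightarrow> nat"
  assumes fin: "\<And>n. finite {a \<in> A. d a = n}"
  shows "fps_nth (Abs_fps (\<lambda>n. \<Sum>a\<in>{a \<in> A. d a = n}. q a) ^ i) m =
    (\<Sum>M\<in>{M. set_mset M \<subseteq> A \<and> size M = i \<and> (\<Sum>u\<in>#M. d u) = m}.
       of_nat (card (permutations_of_multiset M)) * (\<Prod>u\<in>#M. q u))"
proof -
  define L where "L = {xs \<in> lists A. length xs = i \<and> sum_list (map d xs) = m}"
  have fin_L: "finite L" unfolding L_def by (rule fps_power_nth_lists[OF fin])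
  have img: "mset ` L = {M. set_mset M \<subseteq> A \<and> size M = i \<and> (\<Sum>u\<in>#M. d u) = m}"
  proof (intro equalityI subsetI)
    fix M assume M: "M \<in> {M. set_mset M \<subseteq> A \<and> size M = i \<and> (\<Sum>u\<in>#M. d u) = m}"
    obtain xs where "mset xs = M" using ex_mset by blast
    then show "M \<in> mset ` L"
      using M by (intro image_eqI[of _ _ xs]) (auto simp: L_def sum_mset_sum_list[symmetric])
  qed (auto simp: L_def sum_mset_sum_list[symmetric])
  have "fps_nth (Abs_fps (\<lambda>n. \<Sum>a\<in>{a \<in> A. d a = n}. q a) ^ i) m = (\<Sum>xs\<in>L. prod_list (map q xs))"
    unfolding L_def by (rule fps_power_nth_lists[OF fin])
  also have "\<dots> = (\<Sum>M\<in>mset ` L. \<Sum>xs\<in>{xs \<in> L. mset xs = M}. prod_list (map q xs))"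
    by (rule sum.image_gen[OF fin_L])
  also have "\<dots> = (\<Sum>M\<in>mset ` L. of_nat (card (permutations_of_multiset M)) * (\<Prod>u\<in>#M. q u))"
  proof (rule sum.cong[OF refl])
    fix M assume M: "M \<in> mset ` L"
    have "xs \<in> L" if "mset xs = M" for xs
      using M that unfolding img
      by (auto simp: L_def sum_mset_sum_list[symmetric])
    then have "{xs \<in> L. mset xs = M} = permutations_of_multiset M"
      by (auto simp: permutations_of_multiset_def)
    moreover have "prod_list (map q xs) = (\<Prod>u\<in>#M. q u)" if "xs \<in> permutations_of_multiset M" for xs
      using permutations_of_multisetD[OF that] by (auto simp: prod_mset_prod_list[symmetric])
    ultimately show "(\<Sum>xs\<in>{xs \<in> L. mset xs = M}. prod_list (map q xs)) =
        of_nat (card (permutations_of_multiset M)) * (\<Prod>u\<in>#M. q u)" by simp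
  qed
  finally show ?thesis by (simp add: img)
qed

subsection \<open>The solution of the equation\<close>

lemma falling_factorial_eq_gbinomial: "falling_factorial a k = (a gchoose k) * fact k"
  by (simp add: falling_factorial_def gbinomial_prod_rev lessThan_atLeast0)

text \<open>The number of orderings of a multiset is the multinomial coefficient. Its numerator
  cancels the factorial in the binomial coefficient.\<close>

lemma falling_factorial_div_count:
  "falling_factorial a (size M) / (\<Prod>u\<in>set_mset M. fact (count M u)) =
     (a gchoose size M) * real (card (permutations_of_multiset M))"
proof -
  have "real (card (permutations_of_multiset M)) * (\<Prod>u\<in>set_mset M. fact (count M u)) = fact (size M)"
    using arg_cong[OF card_permutations_of_multiset_aux[of M], of real] by simp
  moreover have "(\<Prod>u\<in>set_mset M. fact (count M u) :: real) \<noteq> 0" by simp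
  ultimately show ?thesis
    by (simp add: falling_factorial_eq_gbinomial divide_eq_eq mult.assoc)
qed

text \<open>The factor x^k pushes the k-th summand to order at least k, so each coefficient of the
  infinite sum is a finite sum and the equation becomes a recursion for the coefficients of
  \<open>G\<close>.\<close>

lemma dse_solution_iff:
  assumes "\<And>k. k \<ge> 1 \<Longrightarrow> fls_subdegree (F k) \<ge> -1"
    and "\<And>i k. k \<ge> 1 \<Longrightarrow> c i k = fls_nth (F k) (int i - 1)"
  shows "dse_solution s F G \<longleftrightarrow> fps_nth G 0 = 1 \<and> (\<forall>n\<ge>1. fps_nth G n =
    (\<Sum>k=1..n. mellin_op (\<lambda>i. c i k) (fps_nth (binomial_power G (1 + s * real k)) (n - k))))"
proof -
  let ?f = "\<lambda>k. fps_X ^ k *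
    diff_op_at_0 (binomial_power G (1 + s * real k)) ((exp_L_rho - 1) * fls_pconst (F k))"
  define R where "R = Abs_fps (\<lambda>n. \<Sum>k=1..n.
    mellin_op (\<lambda>i. c i k) (fps_nth (binomial_power G (1 + s * real k)) (n - k)))"
  have f: "fps_nth (?f k) n = (if n < k then 0 else
      mellin_op (\<lambda>i. c i k) (fps_nth (binomial_power G (1 + s * real k)) (n - k)))" if "k \<ge> 1" for k n
    using that assms
    by (simp add: fps_X_power_mult_nth diff_op_at_0_eq_mellin_op[of "F k" "\<lambda>i. c i k"])
  have R: "(?f has_sum R) {1..}"
  proof (rule has_sum_fpsI[where d = "\<lambda>k. k"])
    have eq: "{k \<in> {1..}. k \<le> n} = {1..n}" for n :: nat by auto
    show "finite {k \<in> {1..}. k \<le> n}" for n :: nat by (simp add: eq)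
    show "fps_nth (?f k) m = 0" if "k \<in> {1..}" "m < k" for k m using f that by simp
    show "fps_nth R n = (\<Sum>k\<in>{k \<in> {1..}. k \<le> n}. fps_nth (?f k) n)" for n
      unfolding eq R_def fps_nth_Abs_fps using f by (intro sum.cong) auto
  qed
  \<comment> \<open>Limits are unique in the x-adic topology, so comparison with one known sum
    \<open>R\<close> suffices.\<close>
  have "(?f has_sum (G - 1)) {1..} \<longleftrightarrow> G - 1 = R"
  proof
    assume "(?f has_sum (G - 1)) {1..}"
    from infsumI[OF this] infsumI[OF R] show "G - 1 = R" by (rule trans[OF sym])
  next
    assume "G - 1 = R"
    then show "(?f has_sum (G - 1)) {1..}" by (rule ssubst) (rule R)
  qed
  moreover have "G - 1 = R \<longleftrightarrow> fps_nth G 0 = 1 \<and> (\<forall>n\<ge>1. fps_nth G n = fps_nth R n)"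
    if "fps_nth G 0 = 1"
  proof -
    have "fps_nth (G - 1) n = fps_nth R n \<longleftrightarrow> (n \<ge> 1 \<longrightarrow> fps_nth G n = fps_nth R n)" for n
      using that by (cases n) (auto simp: R_def)
    then show ?thesis using that by (simp only: fps_eq_iff simp_thms)
  qed
  ultimately show ?thesis by (auto simp: dse_solution_def R_def)
qed

text \<open>The recursion for order n only involves orders n - k < n of the binomial powers, and
  these depend only on coefficients of \<open>G\<close> up to the same order.\<close>

lemma dse_solution_unique:
  assumes "\<And>k. k \<ge> 1 \<Longrightarrow> fls_subdegree (F k) \<ge> -1"
    and "dse_solution s F G" "dse_solution s F G'"
  shows "G = G'"
proof (rule fps_ext)
  note iff = dse_solution_iff[OF assms(1), where c = "\<lambda>i k. fls_nth (F k) (int i - 1)"]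
  fix n show "fps_nth G n = fps_nth G' n"
  proof (induction n rule: less_induct)
    case (less n)
    show ?case
    proof (cases "n \<ge> 1")
      case True
      have "fps_nth (binomial_power G (1 + s * real k)) (n - k) =
          fps_nth (binomial_power G' (1 + s * real k)) (n - k)" if "k \<in> {1..n}" for k
        using that less by (intro binomial_power_nth_cong) auto
      then show ?thesis using True assms(2,3) by (simp add: iff)
    next
      case False
      then have "n = 0" by simp
      then show ?thesis using assms(2,3) by (simp add: iff)
    qed
  qed
qed

section \<open>The tree series satisfies the equation\<close>

definition tree_term :: "real \<Rightarrow> (nat \<Rightarrow> nat \<Rightarrow> real) \<Rightarrow> wtree \<Rightarrow> real poly" where
  "tree_term s c t = smult (tree_coeff s t) (tree_poly c t)"

definition tree_series :: "real \<Rightarrow> (nat \<Rightarrow> nat \<Rightarrow> real) \<Rightarrow> real poly fps" where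
  "tree_series s c = Abs_fps (\<lambda>n. \<Sum>t\<in>{t \<in> weighted_trees. tweight t = n}. tree_term s c t)"

lemma finite_weighted_trees_eq: "finite {t \<in> weighted_trees. tweight t = n}"
  by (rule finite_subset[OF _ finite_weighted_trees_le[of n]]) auto

definition forests :: "nat \<Rightarrow> wtree multiset set" where
  "forests m = {M. set_mset M \<subseteq> weighted_trees \<and> (\<Sum>u\<in>#M. tweight u) = m}"

lemma weighted_trees_root_weight:
  assumes "k \<in> {1..n}"
  shows "{t \<in> weighted_trees. tweight t = n \<and> root_weight t = k} = Node k ` forests (n - k)"
proof (intro equalityI subsetI)
  fix t assume t: "t \<in> {t \<in> weighted_trees. tweight t = n \<and> root_weight t = k}"
  then show "t \<in> Node k ` forests (n - k)"
    using tweight_eq[of t] weighted_trees_iff[of t]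
    by (intro image_eqI[of _ _ "subtrees t"]) (auto simp: forests_def)
next
  fix t assume "t \<in> Node k ` forests (n - k)"
  then show "t \<in> {t \<in> weighted_trees. tweight t = n \<and> root_weight t = k}"
    using assms tweight_eq[of t] weighted_trees_iff[of t] by (auto simp: forests_def)
qed

text \<open>Grafting onto a root of weight 1 embeds the forests of weight m into the finitely many
  trees of weight m + 1.\<close>

lemma finite_forests: "finite (forests m)"
proof -
  have eq: "{t \<in> weighted_trees. tweight t = Suc m \<and> root_weight t = 1} = Node 1 ` forests m"
    using weighted_trees_root_weight[of 1 "Suc m"] by simp
  have "finite {t \<in> weighted_trees. tweight t = Suc m \<and> root_weight t = 1}"
    by (rule finite_subset[OF _ finite_weighted_trees_eq[of "Suc m"]]) auto
  then show ?thesis unfolding eq by (simp add: finite_image_iff inj_on_def)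
qed

lemma prod_mset_smult:
  "(\<Prod>u\<in>#M. smult (x u) (p u)) = smult (\<Prod>u\<in>#M. x u) (\<Prod>u\<in>#M. p u)"
  by (induction M) (simp_all add: mult.commute)

text \<open>Expanding the power chooses a multiset of trees, which is then read as the children of a
  root of weight \<open>k\<close>. The exponent 1 + sk supplies the falling factorial of that
  root.\<close>

lemma fps_nth_binomial_power_tree_series:
  "fps_nth (binomial_power (1 + tree_series s c) (1 + s * real k)) m =
     (\<Sum>M\<in>forests m. smult (tree_coeff s (Node k M)) (\<Prod>u\<in>#M. tree_poly c u))"
proof -
  let ?a = "1 + s * real k"
  have eq: "{M. set_mset M \<subseteq> weighted_trees \<and> size M = i \<and> (\<Sum>u\<in>#M. tweight u) = m} =
      {M \<in> forests m. size M = i}" for i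
    by (auto simp: forests_def)
  have "fps_nth (binomial_power (1 + tree_series s c) ?a) m =
      (\<Sum>i=0..m. smult (?a gchoose i) (\<Sum>M\<in>{M \<in> forests m. size M = i}.
        of_nat (card (permutations_of_multiset M)) * (\<Prod>u\<in>#M. tree_term s c u)))"
    unfolding fps_nth_binomial_power tree_series_def
    by (simp add: fps_power_nth_multisets[OF finite_weighted_trees_eq] eq)
  also have "\<dots> = (\<Sum>i=0..m. \<Sum>M\<in>{M \<in> forests m. size M = i}.
        smult (tree_coeff s (Node k M)) (\<Prod>u\<in>#M. tree_poly c u))"
    unfolding smult_sum_right
  proof (intro sum.cong refl)
    fix i M assume "M \<in> {M \<in> forests m. size M = i}"
    then have i: "i = size M" by simp
    \<comment> \<open>Binomial coefficient times number of orderings is the falling factorial of the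
      root divided by the symmetries among equal children.\<close>
    have "tree_coeff s (Node k M) = (?a gchoose i) * real (card (permutations_of_multiset M)) *
        (\<Prod>u\<in>#M. tree_coeff s u)"
      unfolding tree_coeff_eq[of s "Node k M"] i by (simp only: wtree.sel falling_factorial_div_count)
    then show "smult (?a gchoose i) (of_nat (card (permutations_of_multiset M)) *
          (\<Prod>u\<in>#M. tree_term s c u)) = smult (tree_coeff s (Node k M)) (\<Prod>u\<in>#M. tree_poly c u)"
      by (simp add: tree_term_def prod_mset_smult of_nat_poly mult_ac)
  qed
  \<comment> \<open>All weights are positive, so a forest of weight m has at most m trees and
    belongs to exactly one size i in the range.\<close>
  also have "\<dots> = (\<Sum>M\<in>forests m. smult (tree_coeff s (Node k M)) (\<Prod>u\<in>#M. tree_poly c u))"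
  proof (rule sum.group[OF finite_forests])
    show "size ` forests m \<subseteq> {0..m}"
      using size_le_sum_tweight by (auto simp: forests_def)
  qed simp
  finally show ?thesis .
qed

text \<open>Applying \<Lambda> for root weight \<open>k\<close> to the forests of weight n - k
  yields, by \<open>tree_poly_eq\<close>, the trees of weight n with root weight \<open>k\<close>;
  summing over \<open>k\<close> gives all trees of weight n.\<close>

lemma fps_nth_tree_series:
  assumes "n \<ge> 1"
  shows "fps_nth (tree_series s c) n = (\<Sum>k=1..n. mellin_op (\<lambda>i. c i k)
    (fps_nth (binomial_power (1 + tree_series s c) (1 + s * real k)) (n - k)))"
proof -
  have "mellin_op (\<lambda>i. c i k) (fps_nth (binomial_power (1 + tree_series s c) (1 + s * real k)) (n - k)) =
      (\<Sum>t\<in>{t \<in> {t \<in> weighted_trees. tweight t = n}. root_weight t = k}. tree_term s c t)"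
    if k: "k \<in> {1..n}" for k
  proof -
    have "{t \<in> {t \<in> weighted_trees. tweight t = n}. root_weight t = k} = Node k ` forests (n - k)"
      using weighted_trees_root_weight[OF k] by simp
    then show ?thesis
      by (simp add: fps_nth_binomial_power_tree_series mellin_op_sum mellin_op_smult sum.reindex
          inj_on_def tree_term_def tree_poly_eq[of c "Node k _"])
  qed
  then have "(\<Sum>k=1..n. mellin_op (\<lambda>i. c i k)
      (fps_nth (binomial_power (1 + tree_series s c) (1 + s * real k)) (n - k))) =
      (\<Sum>k=1..n. \<Sum>t\<in>{t \<in> {t \<in> weighted_trees. tweight t = n}. root_weight t = k}. tree_term s c t)"
    by (rule sum.cong[OF refl])
  also have "\<dots> = (\<Sum>t\<in>{t \<in> weighted_trees. tweight t = n}. tree_term s c t)"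
  proof (rule sum.group[OF finite_weighted_trees_eq])
    show "root_weight ` {t \<in> weighted_trees. tweight t = n} \<subseteq> {1..n}"
    proof (rule image_subsetI)
      fix t assume "t \<in> {t \<in> weighted_trees. tweight t = n}"
      then show "root_weight t \<in> {1..n}" using tweight_eq[of t] weighted_trees_iff[of t] by auto
    qed
  qed simp
  finally show ?thesis by (simp add: tree_series_def)
qed

lemma fps_nth_tree_series_0: "fps_nth (tree_series s c) 0 = 0"
proof -
  have "{t \<in> weighted_trees. tweight t = 0} = {}" using tweight_pos by force
  then show ?thesis unfolding tree_series_def fps_nth_Abs_fps by (simp only: sum.empty)
qed

text \<open>The coefficient ring is left general because the solution has coefficients in real
  polynomials and the anomalous dimension has real ones.\<close>

lemma has_sum_weighted_trees:
  fixes q :: "wtree \<Rightarrow> 'a :: comm_ring_1"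
  assumes "\<And>n. fps_nth S n = (\<Sum>t\<in>{t \<in> weighted_trees. tweight t = n}. q t)"
  shows "((\<lambda>t. fps_const (q t) * fps_X ^ tweight t) has_sum S) weighted_trees"
proof (rule has_sum_fpsI[where d = tweight, OF finite_weighted_trees_le])
  fix n
  have "(\<Sum>t\<in>{t \<in> weighted_trees. tweight t \<le> n}. fps_nth (fps_const (q t) * fps_X ^ tweight t) n) =
      (\<Sum>t\<in>{t \<in> weighted_trees. tweight t = n}. q t)"
    using finite_weighted_trees_le[of n] by (intro sum.mono_neutral_cong_right) auto
  then show "fps_nth S n =
      (\<Sum>t\<in>{t \<in> weighted_trees. tweight t \<le> n}. fps_nth (fps_const (q t) * fps_X ^ tweight t) n)"
    using assms by simp
qed auto

theorem theorem2p12: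
  fixes s :: real and F :: "nat \<Rightarrow> real fls" and c :: "nat \<Rightarrow> nat \<Rightarrow> real"
  assumes simple_pole: "\<And>k. k \<ge> 1 \<Longrightarrow> fls_subdegree (F k) \<ge> -1"
    and coeffs: "\<And>i k. k \<ge> 1 \<Longrightarrow> c i k = fls_nth (F k) (int i - 1)"
  shows "(\<exists>!G. dse_solution s F G) \<and>
    (\<forall>G. dse_solution s F G \<longrightarrow>
       ((\<lambda>t. fps_const (smult (tree_coeff s t) (\<Sum>\<tau>\<in>Tub t. phi c t \<tau>)) * fps_X ^ tweight t)
          has_sum (G - 1)) weighted_trees \<and>
       ((\<lambda>t. fps_const (tree_coeff s t *
              (\<Sum>\<tau>\<in>Tub t. \<Prod>v\<in>verts t. c (bstat v \<tau> - 1) (vweight t v))) * fps_X ^ tweight t)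
          has_sum Abs_fps (\<lambda>n. coeff (fps_nth G n) 1)) weighted_trees)"
proof -
  let ?G = "1 + tree_series s c"
  have sol: "dse_solution s F ?G"
  proof (rule iffD2[OF dse_solution_iff])
    show "fps_nth ?G 0 = 1 \<and> (\<forall>n\<ge>1. fps_nth ?G n = (\<Sum>k=1..n. mellin_op (\<lambda>i. c i k)
        (fps_nth (binomial_power ?G (1 + s * real k)) (n - k))))"
      by (simp add: fps_nth_tree_series_0 fps_nth_tree_series)
  qed (use simple_pole coeffs in auto)
  have uniq: "G = ?G" if "dse_solution s F G" for G
    using simple_pole that sol by (rule dse_solution_unique)
  have "((\<lambda>t. fps_const (tree_term s c t) * fps_X ^ tweight t) has_sum (?G - 1)) weighted_trees"
    by (rule has_sum_weighted_trees) (simp add: tree_series_def)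
  \<comment> \<open>Extracting the coefficient of L is additive and passes through the finite sum in
    each order of x.\<close>
  moreover have "((\<lambda>t. fps_const (coeff (tree_term s c t) 1) * fps_X ^ tweight t)
      has_sum Abs_fps (\<lambda>n. coeff (fps_nth ?G n) 1)) weighted_trees"
    by (rule has_sum_weighted_trees) (simp add: tree_series_def coeff_sum)
  ultimately have sums: "((\<lambda>t. fps_const (smult (tree_coeff s t) (\<Sum>\<tau>\<in>Tub t. phi c t \<tau>)) * fps_X ^ tweight t)
        has_sum (?G - 1)) weighted_trees \<and>
      ((\<lambda>t. fps_const (tree_coeff s t *
            (\<Sum>\<tau>\<in>Tub t. \<Prod>v\<in>verts t. c (bstat v \<tau> - 1) (vweight t v))) * fps_X ^ tweight t)
        has_sum Abs_fps (\<lambda>n. coeff (fps_nth ?G n) 1)) weighted_trees"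
    unfolding tree_term_def coeff_smult coeff_1_tree_poly unfolding tree_poly_def by (rule conjI)
  show ?thesis
  proof (intro conjI[OF ex1I[of _ ?G]] allI impI)
    fix G assume "dse_solution s F G"
    then have "G = ?G" by (rule uniq)
    then show "((\<lambda>t. fps_const (smult (tree_coeff s t) (\<Sum>\<tau>\<in>Tub t. phi c t \<tau>)) * fps_X ^ tweight t)
          has_sum (G - 1)) weighted_trees \<and>
        ((\<lambda>t. fps_const (tree_coeff s t *
              (\<Sum>\<tau>\<in>Tub t. \<Prod>v\<in>verts t. c (bstat v \<tau> - 1) (vweight t v))) * fps_X ^ tweight t)
          has_sum Abs_fps (\<lambda>n. coeff (fps_nth G n) 1)) weighted_trees"
      using sums by (simp only:)
  qed (use sol uniq in blast)+
qed

end
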